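(* Let $\Delta\subseteq\mathbb{R}^2$ be the Sierpiński triangle of side length one. For any $0<\alpha<1$ we have $$D_{*}(\alpha,\Delta)\leq 1-2^{-\alpha}.$$
   Context: $\Delta$ is the Sierpiński triangle obtained by starting with a (filled, closed) equilateral triangle $\Delta_0\subseteq\mathbb{R}^2$ of side length one: $\Delta=\bigcap_{n=0}^\infty\Delta_n$, where $\Delta_n$ is the union of the $3^n$ closed equilateral triangles of side length $2^{-n}$ appearing at the $n$th step of the standard construction. For $F\subseteq\mathbb{R}^p$, $c>0$ and $0<\alpha\le1$, a function $f:F\to\mathbb{R}$ is $c$-Hölder-$\alpha$ if $|f(x)-f(y)|\le c|x-y|^\alpha$ for all $x,y\in F$. $C_1^\alpha(F)$ denotes the set of 1-Hölder-$\alpha$ functions on $F$, with the metric given by the supremum norm. For $f:F\to\mathbb{R}$ put $D^f(r,F)=\dim_H(f^{-1}(r))$ (Hausdorff dimension, with $\dim_H\emptyset=0$) and $$D_*^f(F)=\sup\{d\ge 0:\lambda\{r\in\mathbb{R}: D^f(r,F)\ge d\}>0\},$$ where $\lambda$ is one-dimensional Lebesgue measure. Let $\mathfrak{G}_{1,\alpha}(F)$ be the collection of all dense $G_\delta$ subsets of $C_1^\alpha(F)$, and define $$D_*(\alpha,F)=\sup_{\mathcal{G}\in\mathfrak{G}_{1,\alpha}(F)}\ \inf\{D_*^f(F): f\in\mathcal{G}\}.$$ *)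

theory Defs
  imports "HOL-Analysis.Analysis"
begin

section \<open>Hausdorff measure and Hausdorff dimension\<close>

text \<open>
  The weight \<open>(diam U)^s\<close> with the usual conventions \<open>(diam {})^s = 0\<close> and
  \<open>(diam U)^0 = 1\<close> for nonempty \<open>U\<close>. The case distinction is needed because
  \<open>0 powr 0 = 0\<close>.
\<close>
definition diam_weight :: "real \<Rightarrow> 'a::metric_space set \<Rightarrow> real" where
  "diam_weight s U = (if U = {} then 0 else if s = 0 then 1 else diameter U powr s)"

text \<open>
  Boundedness of the covering sets is explicit because \<^const>\<open>diameter\<close> is real-valued and
  carries no information for unbounded sets. Finite covers are included by padding with \<open>{}\<close>.
\<close>
definition hausdorff_premeasure :: "real \<Rightarrow> real \<Rightarrow> 'a::metric_space set \<Rightarrow> ennreal" where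
  "hausdorff_premeasure s \<delta> A =
     (INF U \<in> {U :: nat \<Rightarrow> 'a set. A \<subseteq> (\<Union>i. U i) \<and> (\<forall>i. bounded (U i) \<and> diameter (U i) \<le> \<delta>)}.
        \<Sum>i. ennreal (diam_weight s (U i)))"

definition hausdorff_measure :: "real \<Rightarrow> 'a::metric_space set \<Rightarrow> ennreal" where
  "hausdorff_measure s A = (SUP \<delta> \<in> {0<..}. hausdorff_premeasure s \<delta> A)"

definition hausdorff_dim :: "'a::metric_space set \<Rightarrow> ennreal" where
  "hausdorff_dim A = Inf {ennreal s | s. 0 \<le> s \<and> hausdorff_measure s A = 0}"

section \<open>Hoelder functions and the generic level set dimension\<close>

definition holder_on :: "real \<Rightarrow> real \<Rightarrow> 'a::metric_space set \<Rightarrow> ('a \<Rightarrow> real) \<Rightarrow> bool" where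
  "holder_on c \<alpha> F f \<longleftrightarrow> (\<forall>x\<in>F. \<forall>y\<in>F. \<bar>f x - f y\<bar> \<le> c * dist x y powr \<alpha>)"

text \<open>
  The space \<open>C\<^sub>1\<^sup>\<alpha>(F)\<close>. A function on \<open>F\<close> is represented by its extensional extension, and
  \<^const>\<open>funspace\<close> carries the supremum metric. It contains only bounded functions, which is no
  restriction when \<open>F\<close> is bounded (lemma \<open>mspace_holder_space\<close>).
\<close>
definition holder_space :: "real \<Rightarrow> 'a::metric_space set \<Rightarrow> ('a \<Rightarrow> real) metric" where
  "holder_space \<alpha> F = submetric (funspace F euclidean_metric) {f. holder_on 1 \<alpha> F f}"

lemma mspace_holder_space:
  fixes F :: "'a::metric_space set"
  assumes "bounded F" "0 \<le> \<alpha>"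
  shows "mspace (holder_space \<alpha> F) = {f \<in> extensional F. holder_on 1 \<alpha> F f}"
proof -
  have bnd: "bounded (f ` F)" if h: "holder_on 1 \<alpha> F f" for f
  proof (cases "F = {}")
    case False
    then obtain a where a: "a \<in> F" by auto
    obtain e where e: "\<And>y. y \<in> F \<Longrightarrow> dist a y \<le> e"
      using assms(1) bounded_any_center[of F a] by auto
    have "dist (f a) (f y) \<le> e powr \<alpha>" if "y \<in> F" for y
    proof -
      have "\<bar>f a - f y\<bar> \<le> dist a y powr \<alpha>"
        using h a that by (simp add: holder_on_def)
      also have "\<dots> \<le> e powr \<alpha>"
        using e[OF that] assms(2) by (intro powr_mono2) auto
      finally show ?thesis by (simp add: dist_real_def)
    qed
    then show ?thesis unfolding bounded_def by blast
  qed simp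
  then show ?thesis
    by (auto simp: holder_space_def Metric_space.fspace_def[OF Met_TC.Metric_space_axioms]
        Met_TC.fspace_def)
qed

definition level_set_dim :: "'a::metric_space set \<Rightarrow> ('a \<Rightarrow> real) \<Rightarrow> real \<Rightarrow> ennreal" where
  "level_set_dim F f r = hausdorff_dim {x \<in> F. f x = r}"

text \<open>
  \<open>D\<^sub>*\<^sup>f(F)\<close>. On Lebesgue measurable sets \<^const>\<open>outer_measure_of\<close> agrees with the Lebesgue
  measure. For compact \<open>F\<close> and continuous \<open>f\<close> the sets measured here are Borel; the outer
  measure only avoids that \<^const>\<open>emeasure\<close> is \<open>0\<close> by convention on nonmeasurable sets.
\<close>
definition D_star_fun :: "'a::metric_space set \<Rightarrow> ('a \<Rightarrow> real) \<Rightarrow> ennreal" where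
  "D_star_fun F f =
     Sup {ennreal d | d. 0 \<le> d \<and> outer_measure_of lebesgue {r. level_set_dim F f r \<ge> ennreal d} > 0}"

definition dense_gdeltas :: "real \<Rightarrow> 'a::metric_space set \<Rightarrow> ('a \<Rightarrow> real) set set" where
  "dense_gdeltas \<alpha> F =
     {G. gdelta_in (mtopology_of (holder_space \<alpha> F)) G \<and>
         (mtopology_of (holder_space \<alpha> F)) closure_of G = mspace (holder_space \<alpha> F)}"

definition D_star :: "real \<Rightarrow> 'a::metric_space set \<Rightarrow> ennreal" where
  "D_star \<alpha> F = (SUP G \<in> dense_gdeltas \<alpha> F. INF f \<in> G. D_star_fun F f)"

section \<open>The Sierpinski triangle\<close>

text \<open>
  A triangle is represented by its triple of vertices; one step of the construction replaces it
  by its three corner triangles of half the side length.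
\<close>
type_synonym triangle = "(real^2) \<times> (real^2) \<times> (real^2)"

fun corner_triangles :: "triangle \<Rightarrow> triangle set" where
  "corner_triangles (a, b, c) =
     {(a, midpoint a b, midpoint a c), (midpoint a b, b, midpoint b c), (midpoint a c, midpoint b c, c)}"

fun filled_triangle :: "triangle \<Rightarrow> (real^2) set" where
  "filled_triangle (a, b, c) = convex hull {a, b, c}"

primrec sierpinski_triangles :: "triangle \<Rightarrow> nat \<Rightarrow> triangle set" where
  "sierpinski_triangles T 0 = {T}"
| "sierpinski_triangles T (Suc n) = (\<Union>S \<in> sierpinski_triangles T n. corner_triangles S)"

definition sierpinski_stage :: "triangle \<Rightarrow> nat \<Rightarrow> (real^2) set" where
  "sierpinski_stage T n = (\<Union>S \<in> sierpinski_triangles T n. filled_triangle S)"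

definition sierpinski :: "triangle \<Rightarrow> (real^2) set" where
  "sierpinski T = (\<Inter>n. sierpinski_stage T n)"

end

theory Submission
  imports Defs
begin

text \<open>
  Put \<open>p = 2 powr (-\<alpha>)\<close>, so \<open>1/2 < p < 1\<close>, and let \<open>d > 1 - p\<close>. The claim is that for a generic \<open>f\<close> almost
  every level set has dimension at most \<open>d\<close>. By Baire's theorem such functions exist in every dense
  \<open>G\<^sub>\<delta>\<close> set, and letting \<open>d\<close> decrease to \<open>1 - p\<close> gives the bound.

  The number \<open>1 - p\<close> is a slice dimension. Cut the triangle by lines parallel to the side opposite to
  a vertex, and describe the line by the binary digits of its position. Each digit either selects the
  half next to the vertex, which contains one of the three subtriangles, or the other half, which
  contains two. So the slice meets \<open>2 ^ m\<close> triangles of level \<open>N\<close>, where \<open>m\<close> is the number of digits of the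
  second kind. Give the first kind of digit probability \<open>p\<close> and the second kind \<open>1 - p\<close>, independently.
  A typical slice then has \<open>m\<close> close to \<open>(1 - p) * N\<close>, that is, dimension \<open>1 - p\<close>. On the other hand no
  dyadic interval of length \<open>2 ^ -N\<close> has mass above \<open>p ^ N = (2 ^ -N) powr \<alpha>\<close>, so the distribution
  function of this Bernoulli measure is Hoelder of exponent \<open>\<alpha>\<close>, and a function of the position alone
  that follows it has small level sets for almost all of its values.

  Functions of this kind can be planted near any \<open>f\<close>. After shrinking \<open>f\<close> slightly and replacing it by
  a Lipschitz function \<open>k\<close> on the plane (\<open>holder_lipschitz_approximation\<close>), precompose both affine
  coordinates with a staircase that, on each dyadic cell of length \<open>2 ^ -n\<close>, is flat on the first half
  and climbs over the second half like the Bernoulli distribution function. In a triangle of level \<open>n\<close>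
  at most one coordinate can lie in the second half of its cell. So the new function is constant near
  the third vertex and a function of one coordinate near the other two. Its variation over such a
  triangle is of order \<open>2 ^ -n\<close>, while the Hoelder condition allows order \<open>2 powr (-\<alpha> * n)\<close>. As \<open>\<alpha> < 1\<close>,
  a large \<open>n\<close> absorbs all constants, in particular the Lipschitz constant of \<open>k\<close> and the Hoelder constant
  of the staircase (\<open>terraced_holder\<close>).

  The law of large numbers enters through an exponential moment. Let \<open>X r\<close> be the number of
  triangles of level \<open>n + 1 + N\<close> that the level \<open>r\<close> may meet. For \<open>0 < \<theta> \<le> 1\<close> subadditivity of
  \<open>t powr \<theta>\<close> bounds the integral of \<open>X r powr \<theta>\<close> by a constant times \<open>(p + (1 - p) * 2 powr \<theta>) ^ N\<close>. For
  small \<open>\<theta>\<close> this is exponentially smaller than \<open>2 powr (\<theta> * d * N)\<close> (\<open>exponent_beating_entropy\<close>), so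
  Markov's inequality gives \<open>X r \<le> \<eta> * 2 powr (d * N)\<close> outside a set of levels of measure at most \<open>\<eta>\<close>
  (\<open>terraced_thin_levels\<close>). Only finitely many triangles are involved, so the conclusion survives small
  uniform perturbations; this provides the dense open sets for Baire's theorem
  (\<open>D_star_le_if_thin_levels_dense\<close>).
\<close>

section \<open>Lipschitz approximation of Hoelder functions\<close>

lemma subadditive_if_ratio_antimono:
  fixes h :: "real \<Rightarrow> real"
  assumes h0: "0 \<le> h 0"
    and ratio: "\<And>s t. 0 < s \<Longrightarrow> s \<le> t \<Longrightarrow> h t / t \<le> h s / s"
    and st: "0 \<le> s" "0 \<le> t"
  shows "h (s + t) \<le> h s + h t"
proof (cases "s = 0 \<or> t = 0")
  case True
  with h0 show ?thesis by auto
next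
  case False
  with st have pos: "0 < s" "0 < t" by auto
  have "h (s + t) = s * (h (s + t) / (s + t)) + t * (h (s + t) / (s + t))"
    using pos by (simp add: add_divide_distrib[symmetric] distrib_right[symmetric])
  also have "\<dots> \<le> s * (h s / s) + t * (h t / t)"
    using pos by (intro add_mono mult_left_mono ratio) auto
  finally show ?thesis using pos by simp
qed

lemma powr_ratio_antimono:
  fixes \<alpha> :: real
  assumes "\<alpha> \<le> 1" "0 < s" "s \<le> t"
  shows "t powr \<alpha> / t \<le> s powr \<alpha> / s"
proof -
  have "t powr (\<alpha> - 1) \<le> s powr (\<alpha> - 1)"
    using assms by (intro powr_mono2') auto
  then show ?thesis
    using assms by (simp add: powr_diff)
qed

lemma powr_add_le:
  fixes \<alpha> :: real
  assumes "\<alpha> \<le> 1" "0 \<le> s" "0 \<le> t"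
  shows "(s + t) powr \<alpha> \<le> s powr \<alpha> + t powr \<alpha>"
  by (rule subadditive_if_ratio_antimono[where h = "\<lambda>t. t powr \<alpha>"])
     (use assms powr_ratio_antimono in auto)

lemma powr_sum_le:
  fixes \<theta> :: real
  assumes "\<theta> \<le> 1" "finite I" "\<And>i. i \<in> I \<Longrightarrow> 0 \<le> x i"
  shows "(\<Sum>i\<in>I. x i) powr \<theta> \<le> (\<Sum>i\<in>I. x i powr \<theta>)"
  using assms(2,3)
proof (induction I rule: finite_induct)
  case (insert i I)
  have "(\<Sum>i\<in>insert i I. x i) powr \<theta> \<le> x i powr \<theta> + (\<Sum>i\<in>I. x i) powr \<theta>"
    using insert assms(1) by (auto intro!: powr_add_le sum_nonneg)
  also have "\<dots> \<le> (\<Sum>i\<in>insert i I. x i powr \<theta>)"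
    using insert by simp
  finally show ?case .
qed simp

text \<open>
  The minimum of the moduli of continuity of the Hoelder and the Lipschitz condition. It is again
  subadditive, so \<open>modulus c L \<alpha> (dist x y)\<close> behaves like a metric.
\<close>
definition modulus :: "real \<Rightarrow> real \<Rightarrow> real \<Rightarrow> real \<Rightarrow> real" where
  "modulus c L \<alpha> t = min (c * t powr \<alpha>) (L * t)"

lemma modulus_add_le:
  assumes "0 \<le> c" "0 \<le> L" "\<alpha> \<le> 1" "0 \<le> s" "0 \<le> t"
  shows "modulus c L \<alpha> (s + t) \<le> modulus c L \<alpha> s + modulus c L \<alpha> t"
proof (rule subadditive_if_ratio_antimono[where h = "modulus c L \<alpha>"])
  show "modulus c L \<alpha> t / t \<le> modulus c L \<alpha> s / s" if "0 < s" "s \<le> t" for s t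
  proof -
    have "modulus c L \<alpha> u / u = min (c * (u powr \<alpha> / u)) L" if "0 < u" for u
      using that by (auto simp: modulus_def min_def field_simps)
    moreover have "c * (t powr \<alpha> / t) \<le> c * (s powr \<alpha> / s)"
      using that assms powr_ratio_antimono by (intro mult_left_mono) auto
    ultimately show ?thesis using that by auto
  qed
qed (use assms in \<open>auto simp: modulus_def\<close>)

lemma modulus_mono:
  assumes "0 \<le> c" "0 \<le> L" "0 \<le> \<alpha>" "0 \<le> s" "s \<le> t"
  shows "modulus c L \<alpha> s \<le> modulus c L \<alpha> t"
proof -
  have "c * s powr \<alpha> \<le> c * t powr \<alpha>" "L * s \<le> L * t"
    using assms by (auto intro!: mult_left_mono powr_mono2)
  then show ?thesis unfolding modulus_def by linarith
qed

text \<open>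
  The McShane extension \<open>k x = (INF y\<in>F. f y + w (dist x y))\<close> for the modulus \<open>w = modulus c L \<alpha>\<close>.
  The triangle inequality for \<open>w\<close> makes \<open>k\<close> continuous with modulus \<open>w\<close> on the whole space, hence Hoelder
  with the same constant and Lipschitz at once. On \<open>F\<close> the error is at most the largest gap between
  \<open>c * t powr \<alpha>\<close> and \<open>w t\<close>, which tends to 0 as \<open>L\<close> grows.
\<close>
lemma holder_lipschitz_approximation:
  fixes F :: "'a::metric_space set" and f :: "'a \<Rightarrow> real"
  assumes F: "F \<noteq> {}" and bdd: "bounded (f ` F)"
    and c: "0 < c" and \<alpha>: "0 < \<alpha>" "\<alpha> \<le> 1" and hol: "holder_on c \<alpha> F f" and \<epsilon>: "0 < \<epsilon>"
  obtains L k where "0 < L"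
    "\<And>x y. \<bar>k x - k y\<bar> \<le> c * dist x y powr \<alpha>"
    "\<And>x y. \<bar>k x - k y\<bar> \<le> L * dist x y"
    "\<And>x. x \<in> F \<Longrightarrow> \<bar>k x - f x\<bar> \<le> \<epsilon>"
proof -
  \<comment> \<open>The two moduli cross at \<open>s\<close>, where both are equal to \<open>\<epsilon>\<close>; the gap is therefore at most \<open>\<epsilon>\<close>.\<close>
  define s where "s = (\<epsilon> / c) powr (1 / \<alpha>)"
  define L where "L = c * s powr (\<alpha> - 1)"
  have s: "0 < s" "c * s powr \<alpha> = \<epsilon>"
    using \<epsilon> c \<alpha> by (auto simp: s_def powr_powr)
  have L: "0 < L" using c s by (simp add: L_def)
  let ?w = "modulus c L \<alpha>"
  have w0: "0 \<le> ?w t" if "0 \<le> t" for t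
    using that c L by (simp add: modulus_def)
  have w_low: "c * t powr \<alpha> - \<epsilon> \<le> ?w t" if "0 \<le> t" for t
  proof (cases "t \<le> s")
    case True
    have "c * t powr \<alpha> \<le> \<epsilon>"
      using True that c \<alpha> unfolding s(2)[symmetric] by (intro mult_left_mono powr_mono2) auto
    then show ?thesis using w0[OF that] by linarith
  next
    case False
    then have "t powr \<alpha> / t \<le> s powr \<alpha> / s"
      using s \<alpha> by (intro powr_ratio_antimono) auto
    also have "s powr \<alpha> / s = s powr (\<alpha> - 1)"
      using s by (simp add: powr_diff)
    finally have "t powr \<alpha> \<le> s powr (\<alpha> - 1) * t"
      using False s by (simp add: field_simps)
    then have "c * t powr \<alpha> \<le> L * t"
      using c by (simp add: L_def mult.assoc)
    then show ?thesis using \<epsilon> by (simp add: modulus_def)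
  qed
  obtain B where B: "\<And>y. y \<in> F \<Longrightarrow> \<bar>f y\<bar> \<le> B"
    using bdd by (auto simp: bounded_iff)
  define k where "k x = (INF y\<in>F. f y + ?w (dist x y))" for x
  have below: "bdd_below ((\<lambda>y. f y + ?w (dist x y)) ` F)" for x
  proof (rule bdd_belowI2)
    show "- B \<le> f y + ?w (dist x y)" if "y \<in> F" for y
      using B[OF that] w0[of "dist x y"] by (smt (verit) zero_le_dist)
  qed
  have one_sided: "k x - k z \<le> ?w (dist x z)" for x z
  proof -
    have "k x - ?w (dist x z) \<le> k z"
      unfolding k_def[of z]
    proof (rule cINF_greatest[OF F])
      fix y assume y: "y \<in> F"
      have "k x \<le> f y + ?w (dist x y)"
        unfolding k_def by (rule cINF_lower[OF below y])
      also have "?w (dist x y) \<le> ?w (dist x z + dist z y)"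
        using c L \<alpha> by (intro modulus_mono dist_triangle) auto
      also have "\<dots> \<le> ?w (dist x z) + ?w (dist z y)"
        using c L \<alpha> by (intro modulus_add_le) auto
      finally show "k x - ?w (dist x z) \<le> f y + ?w (dist z y)" by simp
    qed
    then show ?thesis by simp
  qed
  have osc: "\<bar>k x - k z\<bar> \<le> ?w (dist x z)" for x z
    using one_sided[of x z] one_sided[of z x] by (simp add: dist_commute abs_le_iff)
  have close: "\<bar>k x - f x\<bar> \<le> \<epsilon>" if x: "x \<in> F" for x
  proof -
    have "k x \<le> f x + ?w (dist x x)"
      unfolding k_def by (rule cINF_lower[OF below x])
    then have "k x \<le> f x" by (simp add: modulus_def)
    moreover have "f x - \<epsilon> \<le> k x"
      unfolding k_def
    proof (rule cINF_greatest[OF F])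
      fix y assume y: "y \<in> F"
      have "f x - f y \<le> c * dist x y powr \<alpha>"
        using hol x y unfolding holder_on_def by (smt (verit))
      then show "f x - \<epsilon> \<le> f y + ?w (dist x y)"
        using w_low[of "dist x y"] by simp
    qed
    ultimately show ?thesis using \<epsilon> by linarith
  qed
  show ?thesis
  proof (rule that[OF L _ _ close])
    show "\<bar>k x - k y\<bar> \<le> c * dist x y powr \<alpha>" "\<bar>k x - k y\<bar> \<le> L * dist x y" for x y
      using osc[of x y] by (auto simp: modulus_def)
  qed
qed


section \<open>Bernoulli distribution functions and staircases\<close>

text \<open>
  The distribution function on the unit interval of a random number whose first \<open>N\<close> binary digits are
  independent and equal to 1 with probability \<open>p\<close>, the remainder being uniform. Truncation after \<open>N\<close>
  digits avoids a limit; all Hoelder bounds below are uniform in \<open>N\<close>.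
\<close>
primrec bernoulli_cdf :: "real \<Rightarrow> nat \<Rightarrow> real \<Rightarrow> real" where
  "bernoulli_cdf p 0 x = x"
| "bernoulli_cdf p (Suc N) x =
     (if x \<le> 1 / 2 then (1 - p) * bernoulli_cdf p N (2 * x)
      else (1 - p) + p * bernoulli_cdf p N (2 * x - 1))"

primrec binary_value :: "bool list \<Rightarrow> real" where
  "binary_value [] = 0"
| "binary_value (b # bs) = (of_bool b + binary_value bs) / 2"

primrec bernoulli_mass :: "real \<Rightarrow> bool list \<Rightarrow> real" where
  "bernoulli_mass p [] = 1"
| "bernoulli_mass p (b # bs) = (if b then p else 1 - p) * bernoulli_mass p bs"

lemma bernoulli_cdf_0 [simp]: "bernoulli_cdf p N 0 = 0"
  by (induction N) auto

lemma bernoulli_cdf_1 [simp]: "bernoulli_cdf p N 1 = 1"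
  by (induction N) auto

lemma bernoulli_cdf_lower_half:
  "z \<le> 1 \<Longrightarrow> bernoulli_cdf p (Suc N) (z / 2) = (1 - p) * bernoulli_cdf p N z"
  by simp

lemma bernoulli_cdf_upper_half:
  assumes "0 \<le> z"
  shows "bernoulli_cdf p (Suc N) ((1 + z) / 2) = (1 - p) + p * bernoulli_cdf p N z"
  using assms by (cases "z = 0") (auto simp: field_simps)

lemma binary_value_bounds:
  "0 \<le> binary_value bs" "binary_value bs + 1 / 2 ^ length bs \<le> 1"
proof (induction bs)
  case (Cons b bs)
  { case 1 then show ?case using Cons by auto }
  { case 2 then show ?case using Cons by (cases b) (auto simp: add_divide_distrib) }
qed auto

lemma bernoulli_mass_nonneg: "0 \<le> p \<Longrightarrow> p \<le> 1 \<Longrightarrow> 0 \<le> bernoulli_mass p bs"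
  by (induction bs) auto

text \<open>
  After \<open>N\<close> prescribed digits the measure is uniform, so the distribution function is affine on the
  dyadic interval, with increment equal to its mass.
\<close>
lemma bernoulli_cdf_affine_on_cylinder:
  assumes "length bs = N" "0 \<le> y" "y \<le> 1"
  shows "bernoulli_cdf p N (binary_value bs + y / 2 ^ N) =
           bernoulli_cdf p N (binary_value bs) + y * bernoulli_mass p bs"
  using assms
proof (induction bs arbitrary: N)
  case (Cons b bs)
  define M where "M = length bs"
  let ?z = "binary_value bs + y / 2 ^ M"
  have N: "N = Suc M" using Cons.prems by (simp add: M_def)
  have IH: "bernoulli_cdf p M ?z = bernoulli_cdf p M (binary_value bs) + y * bernoulli_mass p bs"
    using Cons by (simp add: M_def)
  have "y / 2 ^ M \<le> 1 / 2 ^ M"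
    using Cons.prems by (intro divide_right_mono) auto
  have "0 \<le> y / 2 ^ M" using Cons.prems by simp
  with \<open>y / 2 ^ M \<le> 1 / 2 ^ M\<close> have z: "0 \<le> ?z" "?z \<le> 1" "binary_value bs \<le> 1" "0 \<le> binary_value bs"
    using binary_value_bounds[of bs] unfolding M_def by linarith+
  have x: "binary_value (b # bs) + y / 2 ^ N = (of_bool b + ?z) / 2"
    by (simp add: N field_simps)
  have hd: "bernoulli_cdf p N ((of_bool b + z) / 2) =
      (if b then (1 - p) + p * bernoulli_cdf p M z else (1 - p) * bernoulli_cdf p M z)"
    if "0 \<le> z" "z \<le> 1" for z
    using bernoulli_cdf_lower_half[of z p M] bernoulli_cdf_upper_half[of z p M] that
    unfolding N by (cases b) (simp_all del: bernoulli_cdf.simps)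
  show ?case
    unfolding x unfolding hd[OF z(1,2)] IH binary_value.simps(2) hd[OF z(4,3)] bernoulli_mass.simps(2)
    by (simp add: algebra_simps)
qed simp

lemma bernoulli_cdf_bounds:
  assumes "0 \<le> p" "p \<le> 1" "0 \<le> x" "x \<le> 1"
  shows "0 \<le> bernoulli_cdf p N x" "bernoulli_cdf p N x \<le> 1"
proof -
  have "0 \<le> bernoulli_cdf p N x \<and> bernoulli_cdf p N x \<le> 1"
    using assms(3,4)
  proof (induction N arbitrary: x)
    case (Suc N)
    show ?case
    proof (cases "x \<le> 1 / 2")
      case True
      then have "0 \<le> bernoulli_cdf p N (2 * x) \<and> bernoulli_cdf p N (2 * x) \<le> 1"
        using Suc by auto
      then have "(1 - p) * bernoulli_cdf p N (2 * x) \<le> 1 * 1"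
        using assms by (intro mult_mono) auto
      then show ?thesis using True Suc assms by auto
    next
      case False
      then have b: "0 \<le> bernoulli_cdf p N (2 * x - 1) \<and> bernoulli_cdf p N (2 * x - 1) \<le> 1"
        using Suc by auto
      then have "p * bernoulli_cdf p N (2 * x - 1) \<le> p * 1"
        using assms by (intro mult_mono) auto
      then show ?thesis using False b assms by auto
    qed
  qed simp
  then show "0 \<le> bernoulli_cdf p N x" "bernoulli_cdf p N x \<le> 1" by auto
qed

context
  fixes \<alpha> p :: real
  assumes \<alpha>: "0 < \<alpha>" "\<alpha> < 1" and p_def: "p = 2 powr (- \<alpha>)"
begin

lemma heavy_mass_bounds: "1 / 2 < p" "p < 1" "0 \<le> p" "p \<le> 1" "1 - p \<le> p"
proof -
  have "2 powr (- 1) < (2::real) powr (- \<alpha>)" "2 powr (- \<alpha>) < (2::real) powr 0"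
    using \<alpha> by (intro powr_less_mono; simp)+
  then show "1 / 2 < p" "p < 1" "0 \<le> p" "p \<le> 1" "1 - p \<le> p"
    unfolding p_def by (auto simp: powr_minus)
qed

text \<open>
  Self-similarity at the critical exponent: doubling the argument of \<open>x powr \<alpha>\<close> is compensated exactly
  by the weight \<open>p\<close>. This is why the induction on \<open>N\<close> loses nothing in the estimates below.
\<close>
lemma heavy_half_scaling: "0 \<le> x \<Longrightarrow> p * (2 * x) powr \<alpha> = x powr \<alpha>"
  by (simp add: p_def powr_mult powr_minus)

lemma light_half_scaling: "0 \<le> x \<Longrightarrow> (1 - p) * (2 * x) powr \<alpha> \<le> x powr \<alpha>"
  using mult_right_mono[OF heavy_mass_bounds(5), of "(2 * x) powr \<alpha>"] by (simp add: heavy_half_scaling)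

lemma powr_double_le: "0 \<le> x \<Longrightarrow> (2 * x) powr \<alpha> \<le> 2 * x powr \<alpha>"
  using heavy_half_scaling[of x] mult_right_mono[of "1/2" p "(2 * x) powr \<alpha>"] heavy_mass_bounds by auto

lemma two_powr_ge_one:
  assumes "1 / 2 \<le> x" shows "1 \<le> 2 * x powr \<alpha>"
proof -
  have "1 \<le> (2 * x) powr \<alpha>" using assms \<alpha> by (intro ge_one_powr_ge_zero) auto
  also have "\<dots> \<le> 2 * x powr \<alpha>" using assms by (intro powr_double_le) auto
  finally show ?thesis .
qed

lemma unit_interval_le_powr:
  assumes "0 \<le> x" "x \<le> 1" shows "x \<le> x powr \<alpha>"
  using powr_mono'[of \<alpha> 1 x] assms \<alpha> by simp

text \<open>
  The Hoelder bound is first proved at the two endpoints of the unit interval. There one step of the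
  recursion only rescales, so a fixed constant survives the induction.
\<close>
lemma bernoulli_cdf_le_powr:
  assumes "0 \<le> x" "x \<le> 1"
  shows "bernoulli_cdf p N x \<le> 2 * x powr \<alpha>"
  using assms
proof (induction N arbitrary: x)
  case 0
  then show ?case using unit_interval_le_powr[of x] by auto
next
  case (Suc N)
  show ?case
  proof (cases "x \<le> 1 / 2")
    case True
    then have "bernoulli_cdf p (Suc N) x \<le> (1 - p) * (2 * (2 * x) powr \<alpha>)"
      using Suc heavy_mass_bounds by (auto intro!: mult_left_mono)
    also have "\<dots> \<le> 2 * x powr \<alpha>" using light_half_scaling[of x] Suc by simp
    finally show ?thesis .
  next
    case False
    then show ?thesis
      using bernoulli_cdf_bounds(2)[of p x "Suc N"] two_powr_ge_one[of x] heavy_mass_bounds Suc by linarith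
  qed
qed

lemma bernoulli_cdf_ge_powr:
  assumes "0 \<le> x" "x \<le> 1"
  shows "1 - bernoulli_cdf p N (1 - x) \<le> 2 * x powr \<alpha>"
  using assms
proof (induction N arbitrary: x)
  case 0
  then show ?case using unit_interval_le_powr[of x] by auto
next
  case (Suc N)
  show ?case
  proof (cases "x < 1 / 2")
    case True
    then have "1 - bernoulli_cdf p (Suc N) (1 - x) = p * (1 - bernoulli_cdf p N (1 - 2 * x))"
      by (simp add: algebra_simps)
    also have "\<dots> \<le> p * (2 * (2 * x) powr \<alpha>)"
      using Suc.IH[of "2 * x"] Suc.prems True heavy_mass_bounds by (intro mult_left_mono) auto
    also have "\<dots> = 2 * x powr \<alpha>" using heavy_half_scaling[of x] Suc by simp
    finally show ?thesis .
  next
    case False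
    then show ?thesis
      using bernoulli_cdf_bounds(1)[of p "1 - x" "Suc N"] two_powr_ge_one[of x] heavy_mass_bounds Suc by linarith
  qed
qed

text \<open>
  If both points lie in the same half, self-similarity applies. Otherwise the increment splits at
  \<open>1 / 2\<close> into two one-sided increments, controlled by the endpoint estimates, so no constant accumulates
  along the induction.
\<close>
lemma bernoulli_cdf_holder_ordered:
  assumes "0 \<le> x" "x \<le> y" "y \<le> 1"
  shows "\<bar>bernoulli_cdf p N x - bernoulli_cdf p N y\<bar> \<le> 4 * (y - x) powr \<alpha>"
  using assms
proof (induction N arbitrary: x y)
  case 0
  then show ?case using unit_interval_le_powr[of "y - x"] by auto
next
  case (Suc N)
  let ?B = "bernoulli_cdf p N" and ?S = "bernoulli_cdf p (Suc N)"
  consider "y \<le> 1 / 2" | "x \<le> 1 / 2" "1 / 2 < y" | "1 / 2 < x" by linarith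
  then show ?case
  proof cases
    case 1
    then have "?S x - ?S y = (1 - p) * (?B (2 * x) - ?B (2 * y))"
      using Suc.prems by (simp add: algebra_simps)
    then have "\<bar>?S x - ?S y\<bar> = (1 - p) * \<bar>?B (2 * x) - ?B (2 * y)\<bar>"
      using heavy_mass_bounds by (simp add: abs_mult)
    also have "\<dots> \<le> (1 - p) * (4 * (2 * y - 2 * x) powr \<alpha>)"
      using Suc.IH[of "2 * x" "2 * y"] Suc.prems 1 heavy_mass_bounds by (intro mult_left_mono) auto
    also have "\<dots> \<le> 4 * (y - x) powr \<alpha>"
      using light_half_scaling[of "y - x"] Suc.prems by (simp add: right_diff_distrib)
    finally show ?thesis .
  next
    case 2
    have x: "0 \<le> 1 - 2 * x" "1 - 2 * x \<le> 1" using 2 Suc.prems by auto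
    have y: "0 \<le> 2 * y - 1" "2 * y - 1 \<le> 1" using 2 Suc.prems by auto
    have "?S y - ?S x = (1 - p) * (1 - ?B (2 * x)) + p * ?B (2 * y - 1)"
      using 2 by (simp add: algebra_simps)
    moreover have "0 \<le> (1 - p) * (1 - ?B (2 * x))" "0 \<le> p * ?B (2 * y - 1)"
      using bernoulli_cdf_bounds[of p "2 * x" N] bernoulli_cdf_bounds[of p "2 * y - 1" N] 2 Suc.prems heavy_mass_bounds
      by auto
    moreover have "(1 - p) * (1 - ?B (2 * x)) \<le> 2 * ((1 - p) * (1 - 2 * x) powr \<alpha>)"
      using mult_left_mono[OF bernoulli_cdf_ge_powr[OF x, of N], of "1 - p"] heavy_mass_bounds by simp
    moreover have "(1 - p) * (1 - 2 * x) powr \<alpha> \<le> (1 / 2 - x) powr \<alpha>"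
      using light_half_scaling[of "1 / 2 - x"] 2 by (simp add: right_diff_distrib)
    moreover have "(1 / 2 - x) powr \<alpha> \<le> (y - x) powr \<alpha>"
      using 2 \<alpha> by (intro powr_mono2) auto
    moreover have "p * ?B (2 * y - 1) \<le> 2 * (p * (2 * y - 1) powr \<alpha>)"
      using mult_left_mono[OF bernoulli_cdf_le_powr[OF y, of N], of p] heavy_mass_bounds by simp
    moreover have "p * (2 * y - 1) powr \<alpha> = (y - 1 / 2) powr \<alpha>"
      using heavy_half_scaling[of "y - 1 / 2"] 2 by (simp add: right_diff_distrib)
    moreover have "(y - 1 / 2) powr \<alpha> \<le> (y - x) powr \<alpha>"
      using 2 \<alpha> by (intro powr_mono2) auto
    ultimately show ?thesis by linarith
  next
    case 3
    then have "?S x - ?S y = p * (?B (2 * x - 1) - ?B (2 * y - 1))"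
      using Suc.prems by (simp add: algebra_simps)
    then have "\<bar>?S x - ?S y\<bar> = p * \<bar>?B (2 * x - 1) - ?B (2 * y - 1)\<bar>"
      using heavy_mass_bounds by (simp add: abs_mult)
    also have "\<dots> \<le> p * (4 * (2 * y - 2 * x) powr \<alpha>)"
      using Suc.IH[of "2 * x - 1" "2 * y - 1"] Suc.prems 3 heavy_mass_bounds by (intro mult_left_mono) auto
    also have "\<dots> = 4 * (y - x) powr \<alpha>"
      using heavy_half_scaling[of "y - x"] Suc.prems by (simp add: right_diff_distrib)
    finally show ?thesis by simp
  qed
qed

end

definition corner_ramp :: "real \<Rightarrow> nat \<Rightarrow> real \<Rightarrow> real" where
  "corner_ramp p N x = (if x \<le> 1 / 2 then 0 else bernoulli_cdf p N (2 * x - 1))"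

text \<open>
  The ramp repeated in every integer cell, as a continuous perturbation of the identity. The flat half
  comes first because in the triangle \<open>s + t \<le> 1\<close>, \<open>s, t \<ge> 0\<close> a coordinate above one half forces the
  other one below one half.
\<close>
definition staircase :: "real \<Rightarrow> nat \<Rightarrow> real \<Rightarrow> real" where
  "staircase p N x = of_int \<lfloor>x\<rfloor> + corner_ramp p N (frac x)"

lemma corner_ramp_0 [simp]: "corner_ramp p N 0 = 0" and corner_ramp_1 [simp]: "corner_ramp p N 1 = 1"
  by (auto simp: corner_ramp_def)

lemma corner_ramp_bounds:
  assumes "0 \<le> p" "p \<le> 1" "0 \<le> x" "x \<le> 1"
  shows "0 \<le> corner_ramp p N x" "corner_ramp p N x \<le> 1"
  using bernoulli_cdf_bounds[of p "2 * x - 1" N] assms by (auto simp: corner_ramp_def)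

lemma staircase_on_cell:
  assumes "0 \<le> y" "y \<le> 1"
  shows "staircase p N (of_int k + y) = of_int k + corner_ramp p N y"
proof (cases "y = 1")
  case True
  then have "of_int k + y = of_int (k + 1)" by simp
  then show ?thesis unfolding staircase_def by (simp only: floor_of_int) (simp add: True)
next
  case False
  then have "\<lfloor>of_int k + y\<rfloor> = k" using assms by linarith
  then show ?thesis by (simp add: staircase_def frac_def)
qed

lemma staircase_near:
  assumes "0 \<le> p" "p \<le> 1"
  shows "\<bar>staircase p N x - x\<bar> \<le> 1"
proof -
  have "x = of_int \<lfloor>x\<rfloor> + frac x" by (simp add: frac_def)
  moreover have "0 \<le> frac x" "frac x \<le> 1" using frac_lt_1[of x] by auto
  ultimately show ?thesis
    using corner_ramp_bounds[OF assms, of "frac x" N] unfolding staircase_def by linarith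
qed

lemma corner_ramp_holder_ordered:
  assumes "0 < \<alpha>" "\<alpha> < 1" "p = 2 powr (- \<alpha>)" "0 \<le> x" "x \<le> y" "y \<le> 1"
  shows "\<bar>corner_ramp p N x - corner_ramp p N y\<bar> \<le> 8 * (y - x) powr \<alpha>"
proof -
  have double: "(2 * (y - z)) powr \<alpha> \<le> 2 * (y - x) powr \<alpha>" if "x \<le> z" "z \<le> y" for z
  proof -
    have "(2 * (y - z)) powr \<alpha> \<le> (2 * (y - x)) powr \<alpha>"
      using that assms by (intro powr_mono2) auto
    then show ?thesis using powr_double_le[OF assms(1-3), of "y - x"] assms by simp
  qed
  note p = heavy_mass_bounds[OF assms(1-3)]
  consider "y \<le> 1 / 2" | "x \<le> 1 / 2" "1 / 2 < y" | "1 / 2 < x" by linarith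
  then show ?thesis
  proof cases
    case 1
    then show ?thesis using assms by (simp add: corner_ramp_def)
  next
    case 2
    then have "0 \<le> bernoulli_cdf p N (2 * y - 1)" "bernoulli_cdf p N (2 * y - 1) \<le> 2 * (2 * y - 1) powr \<alpha>"
      using bernoulli_cdf_bounds(1)[of p "2 * y - 1" N] bernoulli_cdf_le_powr[OF assms(1-3), of "2 * y - 1" N]
        assms(4-) p by auto
    moreover have "(2 * y - 1) powr \<alpha> \<le> 2 * (y - x) powr \<alpha>"
      using double[of "1 / 2"] 2 by (simp add: right_diff_distrib)
    moreover have "0 \<le> (y - x) powr \<alpha>" by simp
    ultimately show ?thesis using 2 unfolding corner_ramp_def by simp
  next
    case 3
    then show ?thesis
      using bernoulli_cdf_holder_ordered[OF assms(1-3), of "2 * x - 1" "2 * y - 1" N] double[of x] assms(4-)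
      by (simp add: corner_ramp_def right_diff_distrib)
  qed
qed

text \<open>
  Points at distance at most 1 lie in the same or in adjacent cells; in the second case the increment
  is split at the common endpoint, which doubles the constant.
\<close>
lemma staircase_holder_ordered:
  assumes "0 < \<alpha>" "\<alpha> < 1" "p = 2 powr (- \<alpha>)" "x \<le> y" "y \<le> x + 1"
  shows "\<bar>staircase p N x - staircase p N y\<bar> \<le> 16 * (y - x) powr \<alpha>"
proof -
  have cell: "\<bar>staircase p N u - staircase p N v\<bar> \<le> 8 * (y - x) powr \<alpha>"
    if "of_int k \<le> u" "u \<le> v" "v \<le> of_int k + 1" "x \<le> u" "v \<le> y" for u v k
  proof -
    have "\<bar>corner_ramp p N (u - of_int k) - corner_ramp p N (v - of_int k)\<bar> \<le> 8 * (v - u) powr \<alpha>"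
      using corner_ramp_holder_ordered[OF assms(1-3), of "u - of_int k" "v - of_int k" N] that by simp
    also have "\<dots> \<le> 8 * (y - x) powr \<alpha>"
      using that assms by (intro mult_left_mono powr_mono2) auto
    finally show ?thesis
      using staircase_on_cell[of "u - of_int k" p N k] staircase_on_cell[of "v - of_int k" p N k] that
      by simp
  qed
  define k where "k = \<lfloor>x\<rfloor>"
  have k: "of_int k \<le> x" "x < of_int k + 1" unfolding k_def by linarith+
  have nn: "0 \<le> (y - x) powr \<alpha>" by simp
  show ?thesis
  proof (cases "y \<le> of_int k + 1")
    case True
    then show ?thesis using cell[of k x y] k assms nn by linarith
  next
    case False
    then have "\<bar>staircase p N x - staircase p N (of_int k + 1)\<bar> \<le> 8 * (y - x) powr \<alpha>"
      "\<bar>staircase p N (of_int k + 1) - staircase p N y\<bar> \<le> 8 * (y - x) powr \<alpha>"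
      using cell[of k x "of_int k + 1"] cell[of "k + 1" "of_int k + 1" y] k assms by auto
    then show ?thesis by linarith
  qed
qed

lemma staircase_holder:
  assumes "0 < \<alpha>" "\<alpha> < 1" "p = 2 powr (- \<alpha>)" "\<bar>x - y\<bar> \<le> 1"
  shows "\<bar>staircase p N x - staircase p N y\<bar> \<le> 16 * \<bar>x - y\<bar> powr \<alpha>"
proof (cases "x \<le> y")
  case True
  then show ?thesis using staircase_holder_ordered[OF assms(1-3), of x y N] assms(4) by auto
next
  case False
  then show ?thesis
    using staircase_holder_ordered[OF assms(1-3), of y x N] assms(4) by (auto simp: abs_minus_commute)
qed


section \<open>Hausdorff dimension of almost all level sets\<close>

lemma hausdorff_premeasure_finite_cover:
  fixes A :: "'a::metric_space set"
  assumes I: "finite I" and cov: "A \<subseteq> (\<Union>i\<in>I. V i)"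
    and bdd: "\<And>i. i \<in> I \<Longrightarrow> bounded (V i)" and diam: "\<And>i. i \<in> I \<Longrightarrow> diameter (V i) \<le> D"
    and D: "D \<le> \<delta>" "0 \<le> D" and s: "0 < s"
  shows "hausdorff_premeasure s \<delta> A \<le> ennreal (real (card I) * D powr s)"
proof -
  obtain h where h: "bij_betw h {..<card I} I"
    using ex_bij_betw_nat_finite[OF I] by (auto simp: atLeast0LessThan)
  define U where "U k = (if k < card I then V (h k) else {})" for k
  have hI: "h k \<in> I" if "k < card I" for k
    using h that by (auto simp: bij_betw_def)
  have "A \<subseteq> (\<Union>k. U k)"
  proof
    fix x assume "x \<in> A"
    then obtain i where i: "i \<in> I" "x \<in> V i" using cov by auto
    then obtain k where "k < card I" "h k = i"
      using h by (metis bij_betw_def imageE lessThan_iff)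
    with i show "x \<in> (\<Union>k. U k)" by (auto simp: U_def)
  qed
  moreover have "bounded (U k) \<and> diameter (U k) \<le> \<delta>" for k
    using hI[of k] bdd[of "h k"] order_trans[OF diam[of "h k"] D(1)] D by (cases "k < card I") (auto simp: U_def)
  ultimately have "hausdorff_premeasure s \<delta> A \<le> (\<Sum>k. ennreal (diam_weight s (U k)))"
    unfolding hausdorff_premeasure_def by (intro INF_lower) auto
  also have "\<dots> = (\<Sum>k<card I. ennreal (diam_weight s (U k)))"
    by (rule suminf_finite) (auto simp: U_def diam_weight_def)
  also have "\<dots> \<le> (\<Sum>k<card I. ennreal (D powr s))"
  proof (intro sum_mono ennreal_leI)
    fix k assume "k \<in> {..<card I}"
    then have "diameter (U k) \<le> D" "bounded (U k)"
      using hI diam bdd by (auto simp: U_def)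
    then have "diameter (U k) powr s \<le> D powr s"
      using s diameter_ge_0 by (intro powr_mono2) auto
    then show "diam_weight s (U k) \<le> D powr s"
      using s by (auto simp: diam_weight_def)
  qed
  also have "\<dots> = ennreal (real (card I) * D powr s)"
    by (simp add: ennreal_mult ennreal_of_nat_eq_real_of_nat)
  finally show ?thesis .
qed

lemma hausdorff_premeasure_antimono:
  assumes "\<delta> \<le> \<delta>'"
  shows "hausdorff_premeasure s \<delta>' A \<le> hausdorff_premeasure s \<delta> A"
  unfolding hausdorff_premeasure_def using assms
  by (intro INF_superset_mono) (auto intro: order_trans)

lemma hausdorff_dim_le_if_small_premeasures:
  fixes A :: "'a::metric_space set"
  assumes s: "0 \<le> s"
    and small: "\<And>m. m \<ge> m0 \<Longrightarrow> hausdorff_premeasure s ((1/2) ^ m) A \<le> ennreal ((1/2) ^ m)"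
  shows "hausdorff_dim A \<le> ennreal s"
proof -
  have "hausdorff_premeasure s \<delta> A = 0" if \<delta>: "0 < \<delta>" for \<delta>
  proof -
    have "hausdorff_premeasure s \<delta> A \<le> 0 + ennreal \<epsilon>" if \<epsilon>: "0 < \<epsilon>" for \<epsilon>
    proof -
      have "0 < min \<delta> \<epsilon>" using \<delta> \<epsilon> by simp
      then obtain k where k: "(1/2 :: real) ^ k < min \<delta> \<epsilon>"
        using real_arch_pow_inv[of "min \<delta> \<epsilon>" "1/2"] by force
      define m where "m = max k m0"
      have m: "(1/2 :: real) ^ m \<le> (1/2) ^ k"
        by (rule power_decreasing) (auto simp: m_def)
      have "hausdorff_premeasure s \<delta> A \<le> hausdorff_premeasure s ((1/2) ^ m) A"
        using m k by (intro hausdorff_premeasure_antimono) linarith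
      also have "\<dots> \<le> ennreal ((1/2) ^ m)" by (rule small) (simp add: m_def)
      also have "\<dots> \<le> ennreal \<epsilon>" using m k by (intro ennreal_leI) linarith
      finally show ?thesis by simp
    qed
    then have "hausdorff_premeasure s \<delta> A \<le> 0" by (rule ennreal_le_epsilon)
    then show ?thesis by simp
  qed
  then have "hausdorff_measure s A \<le> 0"
    unfolding hausdorff_measure_def by (intro SUP_least) simp
  then have "ennreal s \<in> {ennreal s | s. 0 \<le> s \<and> hausdorff_measure s A = 0}" using s by auto
  then show ?thesis unfolding hausdorff_dim_def by (rule Inf_lower)
qed

lemma emeasure_tail_union_le:
  assumes E: "\<And>m. E m \<in> sets M" and le: "\<And>m. emeasure M (E m) \<le> ennreal ((1/2) ^ m)"
  shows "emeasure M (\<Union>m\<in>{k..}. E m) \<le> ennreal (2 * (1/2) ^ k)"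
proof -
  have eq: "(\<Union>m\<in>{k..}. E m) = (\<Union>j. E (j + k))"
  proof (rule SUP_eq)
    show "\<exists>j\<in>UNIV. E m \<subseteq> E (j + k)" if "m \<in> {k..}" for m
      using that by (intro bexI[of _ "m - k"]) auto
    show "\<exists>m\<in>{k..}. E (j + k) \<subseteq> E m" for j
      by (intro bexI[of _ "j + k"]) auto
  qed
  have "emeasure M (\<Union>j. E (j + k)) \<le> (\<Sum>j. emeasure M (E (j + k)))"
    using E by (intro emeasure_subadditive_countably) auto
  also have "\<dots> \<le> (\<Sum>j. ennreal ((1/2) ^ (j + k)))"
    using le by (intro suminf_le) auto
  also have "\<dots> = ennreal (\<Sum>j. (1/2) ^ j * (1/2) ^ k)"
    by (simp add: power_add suminf_ennreal2 summable_mult2 summable_geometric)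
  also have "(\<Sum>j. (1/2) ^ j * (1/2) ^ k) = (2::real) * (1/2) ^ k"
    by (subst suminf_mult2[symmetric]) (auto simp: suminf_geometric summable_geometric)
  finally show ?thesis by (simp add: eq)
qed

lemma D_star_fun_le_if_null:
  assumes d: "0 \<le> d"
    and null: "\<And>k. \<exists>N\<in>sets lebesgue. emeasure lebesgue N \<le> ennreal (2 * (1/2) ^ k) \<and>
                 (\<forall>r. r \<notin> N \<longrightarrow> level_set_dim F f r \<le> ennreal d)"
  shows "D_star_fun F f \<le> ennreal d"
  unfolding D_star_fun_def
proof (rule Sup_least, safe)
  fix e :: real assume e: "0 \<le> e" and pos: "0 < outer_measure_of lebesgue {r. ennreal e \<le> level_set_dim F f r}"
  show "ennreal e \<le> ennreal d"
  proof (rule ccontr)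
    assume "\<not> ennreal e \<le> ennreal d"
    then have ed: "d < e" using d by (simp add: ennreal_le_iff2 not_le)
    have "outer_measure_of lebesgue {r. ennreal e \<le> level_set_dim F f r} \<le> 0 + ennreal \<epsilon>"
      if \<epsilon>: "0 < \<epsilon>" for \<epsilon>
    proof -
      obtain k where k: "(1/2 :: real) ^ k < \<epsilon> / 2"
        using real_arch_pow_inv[of "\<epsilon> / 2" "1/2"] \<epsilon> by force
      obtain N where N: "N \<in> sets lebesgue" "emeasure lebesgue N \<le> ennreal (2 * (1/2) ^ k)"
        "\<And>r. r \<notin> N \<Longrightarrow> level_set_dim F f r \<le> ennreal d"
        using null[of k] by auto
      have "{r. ennreal e \<le> level_set_dim F f r} \<subseteq> N"
      proof (safe, rule ccontr)
        fix r assume r: "ennreal e \<le> level_set_dim F f r" "r \<notin> N"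
        then have "ennreal e \<le> ennreal d" using N(3) order_trans by blast
        then show False using ed d e by (simp add: ennreal_le_iff)
      qed
      then have "outer_measure_of lebesgue {r. ennreal e \<le> level_set_dim F f r} \<le> outer_measure_of lebesgue N"
        by (rule outer_measure_of_mono)
      also have "\<dots> \<le> ennreal (2 * (1/2) ^ k)" using N by simp
      also have "\<dots> \<le> ennreal \<epsilon>" using k by (intro ennreal_leI) auto
      finally show ?thesis by simp
    qed
    then have "outer_measure_of lebesgue {r. ennreal e \<le> level_set_dim F f r} \<le> 0"
      by (rule ennreal_le_epsilon)
    with pos show False by simp
  qed
qed

text \<open>
  A finite-scale version of small level sets that is required of all functions uniformly close to \<open>g\<close>,
  with one exceptional set of levels for all of them. Uniformity turns the property into an open
  condition.
\<close>
definition thin_levels_near :: "'a::metric_space set \<Rightarrow> real \<Rightarrow> real \<Rightarrow> ('a \<Rightarrow> real) \<Rightarrow> real \<Rightarrow> bool" where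
  "thin_levels_near F d \<eta> g \<delta> \<longleftrightarrow>
     (\<exists>E\<in>sets lborel. emeasure lborel E \<le> ennreal \<eta> \<and>
        (\<forall>h. (\<forall>x\<in>F. \<bar>h x - g x\<bar> \<le> \<delta>) \<longrightarrow>
           (\<forall>r. r \<notin> E \<longrightarrow> hausdorff_premeasure d \<eta> {x\<in>F. h x = r} \<le> ennreal \<eta>)))"

text \<open>
  Borel-Cantelli: the exceptional sets at the scales \<open>(1/2) ^ m\<close> have summable measures, so almost every
  level is good at all but finitely many scales, and its Hausdorff measure vanishes.
\<close>
lemma D_star_fun_le_if_thin_levels:
  assumes d: "0 \<le> d"
    and thin: "\<And>m. \<exists>g \<delta>. thin_levels_near F d ((1/2) ^ m) g \<delta> \<and> (\<forall>x\<in>F. \<bar>f x - g x\<bar> \<le> \<delta>)"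
  shows "D_star_fun F f \<le> ennreal d"
proof (rule D_star_fun_le_if_null[OF d])
  have "\<exists>E\<in>sets lborel. emeasure lborel E \<le> ennreal ((1/2) ^ m) \<and>
          (\<forall>r. r \<notin> E \<longrightarrow> hausdorff_premeasure d ((1/2) ^ m) {x\<in>F. f x = r} \<le> ennreal ((1/2) ^ m))" for m
  proof -
    obtain g \<delta> where g: "thin_levels_near F d ((1/2) ^ m) g \<delta>" "\<forall>x\<in>F. \<bar>f x - g x\<bar> \<le> \<delta>"
      using thin[of m] by auto
    from g(1) obtain E where "E \<in> sets lborel" "emeasure lborel E \<le> ennreal ((1/2) ^ m)"
      and h: "\<And>h r. \<forall>x\<in>F. \<bar>h x - g x\<bar> \<le> \<delta> \<Longrightarrow> r \<notin> E \<Longrightarrow>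
          hausdorff_premeasure d ((1/2) ^ m) {x\<in>F. h x = r} \<le> ennreal ((1/2) ^ m)"
      unfolding thin_levels_near_def by auto
    then show ?thesis using h[OF g(2)] by (intro bexI[of _ E]) auto
  qed
  then have "\<exists>E. \<forall>m. E m \<in> sets lborel \<and> emeasure lborel (E m) \<le> ennreal ((1/2) ^ m) \<and>
      (\<forall>r. r \<notin> E m \<longrightarrow> hausdorff_premeasure d ((1/2) ^ m) {x\<in>F. f x = r} \<le> ennreal ((1/2) ^ m))"
    by (intro choice) blast
  then obtain E where E: "\<And>m. E m \<in> sets lborel" "\<And>m. emeasure lborel (E m) \<le> ennreal ((1/2) ^ m)"
    "\<And>m r. r \<notin> E m \<Longrightarrow> hausdorff_premeasure d ((1/2) ^ m) {x\<in>F. f x = r} \<le> ennreal ((1/2) ^ m)"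
    by auto
  fix k
  let ?N = "\<Union>m\<in>{k..}. E m"
  have sets: "?N \<in> sets lborel" using E(1) by (intro sets.countable_UN') auto
  then have "?N \<in> sets lebesgue" by (rule sets_completionI_sets)
  moreover have "emeasure lebesgue ?N \<le> ennreal (2 * (1/2) ^ k)"
    using emeasure_tail_union_le[OF E(1,2), of k] sets by simp
  moreover have "level_set_dim F f r \<le> ennreal d" if "r \<notin> ?N" for r
    unfolding level_set_dim_def
  proof (rule hausdorff_dim_le_if_small_premeasures[OF d, of k])
    fix m assume "k \<le> m"
    then have "r \<notin> E m" using that by auto
    then show "hausdorff_premeasure d ((1/2) ^ m) {x\<in>F. f x = r} \<le> ennreal ((1/2) ^ m)" by (rule E(3))
  qed
  ultimately show "\<exists>N\<in>sets lebesgue. emeasure lebesgue N \<le> ennreal (2 * (1/2) ^ k) \<and>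
      (\<forall>r. r \<notin> N \<longrightarrow> level_set_dim F f r \<le> ennreal d)"
    by blast
qed

section \<open>Baire category in the space of Hoelder functions\<close>

lemma mdist_holder_space_le_iff:
  assumes "F \<noteq> {}" "f \<in> mspace (holder_space \<alpha> F)" "g \<in> mspace (holder_space \<alpha> F)"
  shows "mdist (holder_space \<alpha> F) f g \<le> e \<longleftrightarrow> (\<forall>x\<in>F. \<bar>f x - g x\<bar> \<le> e)"
proof -
  have "f \<in> mspace (funspace F euclidean_metric)" "g \<in> mspace (funspace F euclidean_metric)"
    using assms unfolding holder_space_def mspace_submetric by blast+
  from funspace_mdist_le[OF this assms(1)] show ?thesis
    unfolding holder_space_def mdist_submetric by (simp add: dist_real_def)
qed

text \<open>
  The Hoelder condition is an inequality between values at pairs of points, so it passes to uniform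
  limits; the space is closed in the complete space of bounded functions.
\<close>
lemma mcomplete_holder_space:
  fixes F :: "'a::metric_space set"
  assumes F: "F \<noteq> {}"
  shows "mcomplete_of (holder_space \<alpha> F)"
proof -
  let ?X = "funspace F (euclidean_metric :: real metric)"
  let ?H = "{f. holder_on 1 \<alpha> F f} \<inter> mspace ?X"
  interpret X: Metric_space "mspace ?X" "mdist ?X" by (rule Metric_space_mspace_mdist)
  interpret S: Submetric "mspace ?X" "mdist ?X" ?H by unfold_locales auto
  have complete: "X.mcomplete"
  proof -
    have "Met_TC.mcomplete TYPE(real)" by (simp add: complete_UNIV)
    from Met_TC.mcomplete_funspace[OF this, of F] show ?thesis
      by (simp add: mcomplete_of_def Met_TC.Self_def euclidean_metric_def)
  qed
  have "S.sub.mcomplete"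
  proof (rule S.sequentially_closedin_mcomplete_imp_mcomplete[OF complete], elim conjE)
    fix \<sigma> l assume \<sigma>: "range \<sigma> \<subseteq> ?H" and lim: "limitin X.mtopology \<sigma> l sequentially"
    have l: "l \<in> mspace ?X" using lim by (rule X.limitin_mspace)
    have "\<bar>l x - l y\<bar> \<le> 1 * dist x y powr \<alpha>" if xy: "x \<in> F" "y \<in> F" for x y
    proof (rule field_le_epsilon)
      fix e :: real assume e: "0 < e"
      have "\<forall>\<^sub>F n in sequentially. mdist ?X (\<sigma> n) l < e / 2"
        using lim[unfolded X.limitin_metric, THEN conjunct2, rule_format, of "e / 2"] e
        by (auto elim: eventually_mono)
      then obtain n where "mdist ?X (\<sigma> n) l < e / 2" by (auto simp: eventually_sequentially)
      moreover have "\<sigma> n \<in> mspace ?X" "holder_on 1 \<alpha> F (\<sigma> n)" using \<sigma> by blast+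
      ultimately have "\<forall>z\<in>F. \<bar>\<sigma> n z - l z\<bar> \<le> e / 2" "\<bar>\<sigma> n x - \<sigma> n y\<bar> \<le> 1 * dist x y powr \<alpha>"
        using funspace_mdist_le[of "\<sigma> n" F euclidean_metric l "e / 2"] l F xy
        by (auto simp: dist_real_def holder_on_def simp del: mdist_funspace mspace_funspace)
      then show "\<bar>l x - l y\<bar> \<le> 1 * dist x y powr \<alpha> + e"
        using xy by (smt (verit, best) field_sum_of_halves)
    qed
    then show "l \<in> ?H" using l by (auto simp: holder_on_def)
  qed
  then show ?thesis
    unfolding mcomplete_of_def holder_space_def mspace_submetric mdist_submetric .
qed

text \<open>
  The balls around functions with thin levels at scale \<open>(1/2) ^ m\<close> form a dense open set for each \<open>m\<close>.
  A dense \<open>G\<^sub>\<delta>\<close> set is itself an intersection of countably many dense open sets, so by Baire's theorem it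
  contains a function that lies in all of these sets.
\<close>
lemma D_star_le_if_thin_levels_dense:
  fixes F :: "'a::metric_space set"
  assumes F: "F \<noteq> {}" and d: "0 \<le> d"
    and dense: "\<And>f \<epsilon> \<eta>. f \<in> mspace (holder_space \<alpha> F) \<Longrightarrow> 0 < \<epsilon> \<Longrightarrow> 0 < \<eta> \<Longrightarrow>
       \<exists>g\<in>mspace (holder_space \<alpha> F). \<exists>\<delta>>0. (\<forall>x\<in>F. \<bar>f x - g x\<bar> \<le> \<epsilon>) \<and> thin_levels_near F d \<eta> g \<delta>"
    and ne: "mspace (holder_space \<alpha> F) \<noteq> {}"
  shows "D_star \<alpha> F \<le> ennreal d"
proof -
  let ?C = "holder_space \<alpha> F"
  interpret C: Metric_space "mspace ?C" "mdist ?C" by (rule Metric_space_mspace_mdist)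
  have top: "mtopology_of ?C = C.mtopology" by (simp add: mtopology_of_def)
  have complete: "C.mcomplete" using mcomplete_holder_space[OF F] by (simp add: mcomplete_of_def)
  define W where "W m = (\<Union>(g,\<delta>)\<in>{(g,\<delta>). 0 < \<delta> \<and> thin_levels_near F d ((1/2) ^ m) g \<delta>}. C.mball g \<delta>)" for m
  have W_open: "openin C.mtopology (W m)" for m
    unfolding W_def by (intro openin_Union) auto
  have W_dense: "C.mtopology closure_of (W m) = mspace ?C" for m
  proof -
    have "\<exists>y\<in>W m. y \<in> C.mcball f \<epsilon>" if f: "f \<in> mspace ?C" and \<epsilon>: "0 < \<epsilon>" for f \<epsilon>
    proof -
      obtain g \<delta> where g: "g \<in> mspace ?C" "0 < \<delta>" "\<forall>x\<in>F. \<bar>f x - g x\<bar> \<le> \<epsilon>" "thin_levels_near F d ((1/2) ^ m) g \<delta>"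
        using dense[OF f \<epsilon>, of "(1/2) ^ m"] by auto
      have "g \<in> C.mball g \<delta>" using g by simp
      then have "g \<in> W m" unfolding W_def using g by blast
      moreover have "g \<in> C.mcball f \<epsilon>"
        using g f mdist_holder_space_le_iff[OF F f g(1)] by simp
      ultimately show ?thesis by blast
    qed
    then show ?thesis unfolding C.metric_closure_of_alt by auto
  qed
  have good: "D_star_fun F f \<le> ennreal d" if f: "f \<in> mspace ?C" "\<And>m. f \<in> W m" for f
  proof (rule D_star_fun_le_if_thin_levels[OF d])
    fix m
    obtain g \<delta> where g: "thin_levels_near F d ((1/2) ^ m) g \<delta>" "f \<in> C.mball g \<delta>"
      using f(2)[of m] unfolding W_def by auto
    then have "\<forall>x\<in>F. \<bar>g x - f x\<bar> \<le> \<delta>"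
      using mdist_holder_space_le_iff[OF F, of g \<alpha> f \<delta>] by simp
    then show "\<exists>g \<delta>. thin_levels_near F d ((1/2) ^ m) g \<delta> \<and> (\<forall>x\<in>F. \<bar>f x - g x\<bar> \<le> \<delta>)"
      using g by (metis abs_minus_commute)
  qed
  show ?thesis
    unfolding D_star_def
  proof (rule SUP_least)
    fix G assume "G \<in> dense_gdeltas \<alpha> F"
    then have gd: "gdelta_in C.mtopology G" and G_dense: "C.mtopology closure_of G = mspace ?C"
      unfolding dense_gdeltas_def top by auto
    from gd obtain \<U> where \<U>: "countable \<U>" "\<And>U. U \<in> \<U> \<Longrightarrow> openin C.mtopology U" "\<Inter>\<U> = G"
      unfolding gdelta_in_alt intersection_of_def by auto
    have "C.mtopology closure_of \<Inter>(\<U> \<union> range W) = mspace ?C"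
    proof (rule C.metric_Baire_category[OF complete])
      show "countable (\<U> \<union> range W)" using \<U> by auto
      fix T assume "T \<in> \<U> \<union> range W"
      then consider "T \<in> \<U>" | m where "T = W m" by auto
      then show "openin C.mtopology T \<and> C.mtopology closure_of T = mspace ?C"
      proof cases
        case 1
        then have "G \<subseteq> T" using \<U>(3) by auto
        then have "mspace ?C \<subseteq> C.mtopology closure_of T" using closure_of_mono G_dense by metis
        then show ?thesis
          using \<U>(2)[OF 1] closure_of_subset_topspace[of C.mtopology T] by auto
      qed (use W_open W_dense in auto)
    qed
    then obtain f where f: "f \<in> \<Inter>(\<U> \<union> range W)" using ne closure_of_empty[of C.mtopology] by (metis ex_in_conv)
    then have fG: "f \<in> G" using \<U>(3) by auto
    have "f \<in> mspace ?C" using fG gdelta_in_subset[OF gd] by auto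
    then have "D_star_fun F f \<le> ennreal d" using good f by auto
    then show "(INF f\<in>G. D_star_fun F f) \<le> ennreal d" using fG by (meson INF_lower2)
  qed
qed

section \<open>Multiplicity of weighted intervals\<close>

text \<open>
  Markov's inequality for the sum of weighted indicator functions of intervals. The strict inequality in
  the hypothesis leaves room to enlarge every interval by \<open>\<delta>\<close>; this slack later absorbs a uniform
  perturbation of the function.
\<close>
lemma weighted_interval_multiplicity:
  fixes c \<rho> w :: "'i \<Rightarrow> real"
  assumes I: "finite I" and w: "\<And>i. i \<in> I \<Longrightarrow> 0 \<le> w i" and \<rho>: "\<And>i. i \<in> I \<Longrightarrow> 0 \<le> \<rho> i"
    and lam: "0 < \<Lambda>" and small: "(\<Sum>i\<in>I. 2 * \<rho> i * w i) < \<Lambda> * \<eta>"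
  obtains \<delta> E where "0 < \<delta>" "E \<in> sets lborel" "emeasure lborel E \<le> ennreal \<eta>"
    "\<And>r. r \<notin> E \<Longrightarrow> (\<Sum>i\<in>{i\<in>I. \<bar>r - c i\<bar> \<le> \<rho> i + \<delta>}. w i) \<le> \<Lambda>"
proof -
  define s where "s = (\<Sum>i\<in>I. w i)"
  have s: "0 \<le> s" using w by (auto simp: s_def intro: sum_nonneg)
  define gap where "gap = \<Lambda> * \<eta> - (\<Sum>i\<in>I. 2 * \<rho> i * w i)"
  \<comment> \<open>Enlarging all intervals by \<open>\<delta>\<close> raises the integral by \<open>2 * \<delta> * s\<close>, which must fit in the gap.\<close>
  define \<delta> where "\<delta> = gap / (2 * s + 1)"
  have gap: "0 < gap" using small by (simp add: gap_def)
  have \<delta>: "0 < \<delta>" "2 * \<delta> * s \<le> gap" using gap s by (auto simp: \<delta>_def field_simps)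
  let ?J = "\<lambda>i. {c i - \<rho> i - \<delta> .. c i + \<rho> i + \<delta>}"
  let ?u = "\<lambda>r. \<Sum>i\<in>I. ennreal (w i) * indicator (?J i) r"
  define E where "E = {r \<in> space lborel. 1 \<le> ennreal (1 / \<Lambda>) * ?u r}"
  have E: "E \<in> sets lborel" unfolding E_def by measurable
  have "emeasure lborel E \<le> ennreal (1 / \<Lambda>) * (\<integral>\<^sup>+ r. ?u r * indicator (space lborel) r \<partial>lborel)"
    unfolding E_def by (intro nn_integral_Markov_inequality) auto
  also have "(\<integral>\<^sup>+ r. ?u r * indicator (space lborel) r \<partial>lborel) = (\<Sum>i\<in>I. ennreal (w i) * emeasure lborel (?J i))"
    by (simp add: nn_integral_sum nn_integral_cmult)
  also have "\<dots> = (\<Sum>i\<in>I. ennreal (w i * (2 * \<rho> i + 2 * \<delta>)))"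
  proof (rule sum.cong[OF refl])
    fix i assume i: "i \<in> I"
    have "emeasure lborel (?J i) = ennreal (2 * \<rho> i + 2 * \<delta>)"
      using \<rho>[OF i] \<delta> by simp
    then show "ennreal (w i) * emeasure lborel (?J i) = ennreal (w i * (2 * \<rho> i + 2 * \<delta>))"
      using w[OF i] \<rho>[OF i] \<delta> by (simp add: ennreal_mult)
  qed
  also have "\<dots> = ennreal (\<Sum>i\<in>I. w i * (2 * \<rho> i + 2 * \<delta>))"
    using w \<rho> \<delta> by (intro sum_ennreal mult_nonneg_nonneg add_nonneg_nonneg) auto
  also have "(\<Sum>i\<in>I. w i * (2 * \<rho> i + 2 * \<delta>)) = (\<Sum>i\<in>I. 2 * \<rho> i * w i) + 2 * \<delta> * s"
    by (simp add: s_def sum_distrib_left sum_distrib_right sum.distrib algebra_simps)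
  also have "ennreal (1 / \<Lambda>) * ennreal \<dots> \<le> ennreal (1 / \<Lambda>) * ennreal (\<Lambda> * \<eta>)"
    using \<delta> by (intro mult_left_mono ennreal_leI) (auto simp: gap_def)
  also have "\<dots> = ennreal \<eta>"
    using lam by (subst ennreal_mult'[symmetric]) auto
  finally have E_small: "emeasure lborel E \<le> ennreal \<eta>" .
  have "(\<Sum>i\<in>{i\<in>I. \<bar>r - c i\<bar> \<le> \<rho> i + \<delta>}. w i) \<le> \<Lambda>" if "r \<notin> E" for r
  proof (rule ccontr)
    assume *: "\<not> ?thesis"
    have "?u r = (\<Sum>i\<in>I. ennreal (if \<bar>r - c i\<bar> \<le> \<rho> i + \<delta> then w i else 0))"
      by (intro sum.cong) (auto simp: indicator_def abs_le_iff)
    also have "\<dots> = ennreal (\<Sum>i\<in>I. if \<bar>r - c i\<bar> \<le> \<rho> i + \<delta> then w i else 0)"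
      using w by (intro sum_ennreal) auto
    also have "(\<Sum>i\<in>I. if \<bar>r - c i\<bar> \<le> \<rho> i + \<delta> then w i else 0) = (\<Sum>i\<in>{i\<in>I. \<bar>r - c i\<bar> \<le> \<rho> i + \<delta>}. w i)"
      using I by (simp add: sum.inter_filter)
    finally have u: "?u r = ennreal (\<Sum>i\<in>{i\<in>I. \<bar>r - c i\<bar> \<le> \<rho> i + \<delta>}. w i)" .
    have "1 = ennreal (1 / \<Lambda>) * ennreal \<Lambda>"
      using lam by (subst ennreal_mult'[symmetric]) auto
    also have "\<dots> \<le> ennreal (1 / \<Lambda>) * ?u r"
      unfolding u using * by (intro mult_left_mono ennreal_leI) auto
    finally show False using that by (simp add: E_def)
  qed
  with \<delta> E E_small show ?thesis using that by blast
qed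


section \<open>Addresses in the Sierpinski triangle\<close>

definition words :: "nat \<Rightarrow> nat list set" where
  "words n = {w. length w = n \<and> set w \<subseteq> {..<3}}"

text \<open>
  A word over \<open>{0, 1, 2}\<close> lists the corners chosen at the successive steps, where 0, 1, 2 stand for the
  vertices \<open>a\<close>, \<open>a + e\<close>, \<open>a + f\<close>. Choosing corner 1 appends a binary digit 1 to the coefficient of \<open>e\<close>, choosing
  corner 2 to that of \<open>f\<close>. So \<open>bits 1 w\<close> and \<open>bits 2 w\<close> are the digits of the affine coordinates of the
  subtriangle.
\<close>
definition bits :: "nat \<Rightarrow> nat list \<Rightarrow> bool list" where
  "bits i w = map (\<lambda>d. d = i) w"

definition affine_point :: "'a::real_vector \<Rightarrow> 'a \<Rightarrow> 'a \<Rightarrow> real \<Rightarrow> real \<Rightarrow> 'a" where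
  "affine_point a e f s t = a + s *\<^sub>R e + t *\<^sub>R f"

definition cell :: "'a::real_vector \<Rightarrow> 'a \<Rightarrow> 'a \<Rightarrow> nat list \<Rightarrow> 'a set" where
  "cell a e f w = {affine_point a e f (binary_value (bits 1 w) + \<sigma> / 2 ^ length w)
                                      (binary_value (bits 2 w) + \<tau> / 2 ^ length w) |
                   \<sigma> \<tau>. 0 \<le> \<sigma> \<and> 0 \<le> \<tau> \<and> \<sigma> + \<tau> \<le> 1}"

lemma finite_words [simp]: "finite (words n)"
  unfolding words_def using finite_lists_length_eq[of "{..<3::nat}" n] by (simp add: conj_commute)

lemma card_words: "card (words n) = 3 ^ n"
  unfolding words_def using card_lists_length_eq[of "{..<3::nat}" n] by (simp add: conj_commute)

lemma length_bits [simp]: "length (bits i w) = length w"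
  by (simp add: bits_def)

lemma bits_append [simp]: "bits i (u @ v) = bits i u @ bits i v"
  and bits_Cons [simp]: "bits i (d # v) = (d = i) # bits i v"
  and bits_Nil [simp]: "bits i [] = []"
  by (auto simp: bits_def)

lemma binary_value_append:
  "binary_value (u @ v) = binary_value u + binary_value v / 2 ^ length u"
  by (induction u) (auto simp: field_simps)

lemma binary_value_scaled_Ints: "2 ^ length u * binary_value u \<in> \<int>"
proof (induction u)
  case (Cons b u)
  have "2 ^ length (b # u) * binary_value (b # u) = 2 ^ length u * of_bool b + 2 ^ length u * binary_value u"
    by (simp add: field_simps)
  then show ?case using Cons by simp
qed simp

text \<open>
  The triangles of one level are translates of a single scaled copy of the initial triangle, so each
  is determined by its first vertex, whose coordinates are read off from the address.
\<close>
lemma sierpinski_triangles_addressed: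
  assumes "T \<in> sierpinski_triangles (a, a + e, a + f) n"
  shows "\<exists>w\<in>words n. T = (affine_point a e f (binary_value (bits 1 w)) (binary_value (bits 2 w)),
      affine_point a e f (binary_value (bits 1 w) + 1 / 2 ^ n) (binary_value (bits 2 w)),
      affine_point a e f (binary_value (bits 1 w)) (binary_value (bits 2 w) + 1 / 2 ^ n))"
  using assms
proof (induction n arbitrary: T)
  case 0
  then show ?case by (simp add: words_def affine_point_def)
next
  case (Suc n)
  then obtain S where S: "S \<in> sierpinski_triangles (a, a + e, a + f) n" "T \<in> corner_triangles S"
    by auto
  obtain w where w: "w \<in> words n" and Seq: "S =
      (affine_point a e f (binary_value (bits 1 w)) (binary_value (bits 2 w)),
      affine_point a e f (binary_value (bits 1 w) + 1 / 2 ^ n) (binary_value (bits 2 w)),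
      affine_point a e f (binary_value (bits 1 w)) (binary_value (bits 2 w) + 1 / 2 ^ n))"
    using Suc.IH[OF S(1)] by auto
  have len: "length w = n" using w by (simp add: words_def)
  have words: "w @ [d] \<in> words (Suc n)" if "d < 3" for d
    using w that by (auto simp: words_def)
  have mid: "midpoint (affine_point a e f s t) (affine_point a e f s' t') =
      affine_point a e f ((s + s') / 2) ((t + t') / 2)" for s s' t t'
  proof -
    have "r *\<^sub>R v + r' *\<^sub>R v = ((r + r') / 2) *\<^sub>R v + ((r + r') / 2) *\<^sub>R v" for r r' and v :: "real^2"
      by (simp flip: scaleR_add_left)
    then show ?thesis unfolding midpoint_eq_iff affine_point_def by (simp add: ac_simps)
  qed
  have half: "(x + (x + 1 / 2 ^ n)) / 2 = x + 1 / 2 ^ Suc n" "((x + 1 / 2 ^ n) + x) / 2 = x + 1 / 2 ^ Suc n"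
    "x + 1 / 2 ^ Suc n + 1 / 2 ^ Suc n = x + 1 / 2 ^ n" for x :: real
    by (auto simp: field_simps)
  have val: "binary_value (bits j (w @ [d])) = binary_value (bits j w) + of_bool (d = j) / 2 ^ Suc n" for j d
    by (simp add: binary_value_append len)
  have "\<exists>d<3. T = (affine_point a e f (binary_value (bits 1 (w @ [d]))) (binary_value (bits 2 (w @ [d]))),
      affine_point a e f (binary_value (bits 1 (w @ [d])) + 1 / 2 ^ Suc n) (binary_value (bits 2 (w @ [d]))),
      affine_point a e f (binary_value (bits 1 (w @ [d]))) (binary_value (bits 2 (w @ [d])) + 1 / 2 ^ Suc n))"
    (is "\<exists>d<3. T = ?C d")
  proof -
    have "T = ?C 0 \<or> T = ?C 1 \<or> T = ?C 2"
      using S(2) unfolding Seq corner_triangles.simps insert_iff empty_iff mid half val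
      by (simp del: power_Suc add: half)
    then show ?thesis by (metis numeral_3_eq_3 lessI less_Suc_eq numeral_2_eq_2 One_nat_def zero_less_Suc)
  qed
  then obtain d where "d < 3" "T = ?C d" by blast
  then show ?case using words[of d] by blast
qed

lemma sierpinski_subset_cells:
  assumes "x \<in> sierpinski (a, a + e, a + f)"
  shows "\<exists>w\<in>words n. x \<in> cell a e f w"
proof -
  have "x \<in> sierpinski_stage (a, a + e, a + f) n" using assms by (auto simp: sierpinski_def)
  then obtain T where T: "T \<in> sierpinski_triangles (a, a + e, a + f) n" "x \<in> filled_triangle T"
    by (auto simp: sierpinski_stage_def)
  from sierpinski_triangles_addressed[OF T(1)] obtain w where w: "w \<in> words n"
    and Teq: "T = (affine_point a e f (binary_value (bits 1 w)) (binary_value (bits 2 w)),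
      affine_point a e f (binary_value (bits 1 w) + 1 / 2 ^ n) (binary_value (bits 2 w)),
      affine_point a e f (binary_value (bits 1 w)) (binary_value (bits 2 w) + 1 / 2 ^ n))" by auto
  let ?s = "binary_value (bits 1 w)" and ?t = "binary_value (bits 2 w)"
  obtain \<mu> \<sigma> \<tau> where c: "0 \<le> \<mu>" "0 \<le> \<sigma>" "0 \<le> \<tau>" "\<mu> + \<sigma> + \<tau> = 1"
    and x: "x = \<mu> *\<^sub>R affine_point a e f ?s ?t + \<sigma> *\<^sub>R affine_point a e f (?s + 1 / 2 ^ n) ?t
             + \<tau> *\<^sub>R affine_point a e f ?s (?t + 1 / 2 ^ n)"
    using T(2) unfolding Teq filled_triangle.simps convex_hull_3 by auto
  have "x = (\<mu> + \<sigma> + \<tau>) *\<^sub>R affine_point a e f ?s ?t + (\<sigma> / 2 ^ n) *\<^sub>R e + (\<tau> / 2 ^ n) *\<^sub>R f"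
    unfolding x by (simp add: affine_point_def algebra_simps)
  then have "x = affine_point a e f (?s + \<sigma> / 2 ^ length w) (?t + \<tau> / 2 ^ length w)"
    using w unfolding c(4) by (simp add: affine_point_def words_def algebra_simps)
  moreover have "\<sigma> + \<tau> \<le> 1" using c by linarith
  ultimately show ?thesis using c w unfolding cell_def by blast
qed

lemma vertex_in_sierpinski: "a \<in> sierpinski (a, b, c)"
proof -
  have "\<exists>b' c'. (a, b', c') \<in> sierpinski_triangles (a, b, c) n" for n
  proof (induction n)
    case (Suc n)
    then obtain b' c' where "(a, b', c') \<in> sierpinski_triangles (a, b, c) n" by auto
    then have "(a, midpoint a b', midpoint a c') \<in> sierpinski_triangles (a, b, c) (Suc n)"
      by (auto intro!: bexI)
    then show ?case by blast
  qed auto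
  moreover have "a \<in> filled_triangle (a, b', c')" for b' c'
    by (simp add: hull_inc)
  ultimately show ?thesis unfolding sierpinski_def sierpinski_stage_def by blast
qed

lemma bounded_sierpinski: "bounded (sierpinski (a, b, c))"
proof (rule bounded_subset)
  show "bounded (convex hull {a, b, c})" by (simp add: bounded_convex_hull)
  show "sierpinski (a, b, c) \<subseteq> convex hull {a, b, c}"
  proof
    fix x assume "x \<in> sierpinski (a, b, c)"
    then have "x \<in> sierpinski_stage (a, b, c) 0" unfolding sierpinski_def by blast
    then show "x \<in> convex hull {a, b, c}" by (simp add: sierpinski_stage_def)
  qed
qed

lemma cell_diameter:
  fixes a e f :: "'a::euclidean_space"
  assumes "norm e \<le> 1" "norm f \<le> 1"
  shows "bounded (cell a e f w)" "diameter (cell a e f w) \<le> 2 / 2 ^ length w"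
proof -
  have dist: "norm (x - y) \<le> 2 / 2 ^ length w" if xy: "x \<in> cell a e f w" "y \<in> cell a e f w" for x y
  proof -
    from xy obtain \<sigma> \<tau> \<sigma>' \<tau>' where st: "0 \<le> \<sigma>" "0 \<le> \<tau>" "\<sigma> + \<tau> \<le> 1" "0 \<le> \<sigma>'" "0 \<le> \<tau>'" "\<sigma>' + \<tau>' \<le> 1"
      and x: "x = affine_point a e f (binary_value (bits 1 w) + \<sigma> / 2 ^ length w) (binary_value (bits 2 w) + \<tau> / 2 ^ length w)"
      and y: "y = affine_point a e f (binary_value (bits 1 w) + \<sigma>' / 2 ^ length w) (binary_value (bits 2 w) + \<tau>' / 2 ^ length w)"
      unfolding cell_def by blast
    have "x - y = (1 / 2 ^ length w) *\<^sub>R ((\<sigma> - \<sigma>') *\<^sub>R e + (\<tau> - \<tau>') *\<^sub>R f)"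
      unfolding x y by (simp add: affine_point_def algebra_simps diff_divide_distrib)
    then have "norm (x - y) = 1 / 2 ^ length w * norm ((\<sigma> - \<sigma>') *\<^sub>R e + (\<tau> - \<tau>') *\<^sub>R f)"
      by simp
    also have "norm ((\<sigma> - \<sigma>') *\<^sub>R e + (\<tau> - \<tau>') *\<^sub>R f) \<le> \<bar>\<sigma> - \<sigma>'\<bar> * norm e + \<bar>\<tau> - \<tau>'\<bar> * norm f"
      by (rule order_trans[OF norm_triangle_ineq]) simp
    also have "\<dots> \<le> 1 * 1 + 1 * 1"
      using st assms by (intro add_mono mult_mono) auto
    finally show ?thesis by (simp add: divide_right_mono)
  qed
  then show "bounded (cell a e f w)" unfolding bounded_def by (metis dist_norm)
  show "diameter (cell a e f w) \<le> 2 / 2 ^ length w"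
    using dist by (intro diameter_le) auto
qed

section \<open>Counting triangles in a slice\<close>

lemma finite_bool_lists [simp]: "finite {\<beta> :: bool list. length \<beta> = N}"
  using finite_lists_length_eq[of "UNIV :: bool set" N] by simp

lemma sum_bool_lists_Suc:
  fixes f :: "bool list \<Rightarrow> 'a::comm_monoid_add"
  shows "(\<Sum>\<beta> | length \<beta> = Suc N. f \<beta>) = (\<Sum>\<beta> | length \<beta> = N. f (True # \<beta>) + f (False # \<beta>))"
proof -
  have "{\<beta> :: bool list. length \<beta> = Suc N} = (#) True ` {\<beta>. length \<beta> = N} \<union> (#) False ` {\<beta>. length \<beta> = N}"
    by (force simp: length_Suc_conv)
  then have "(\<Sum>\<beta> | length \<beta> = Suc N. f \<beta>) =
      sum f ((#) True ` {\<beta>. length \<beta> = N}) + sum f ((#) False ` {\<beta>. length \<beta> = N})"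
    by (auto intro!: sum.union_disjoint)
  then show ?thesis by (simp add: sum.reindex sum.distrib)
qed

text \<open>
  The probability generating function of a binomial distribution, at \<open>b\<close>: the digits are independent, so
  the sum factorises.
\<close>
lemma sum_bernoulli_mass_times_power:
  fixes b :: real
  shows "(\<Sum>\<beta> | length \<beta> = N. bernoulli_mass p \<beta> * b ^ count_list \<beta> False) = (p + (1 - p) * b) ^ N"
proof (induction N)
  case (Suc N)
  have "(\<Sum>\<beta> | length \<beta> = Suc N. bernoulli_mass p \<beta> * b ^ count_list \<beta> False) =
      (\<Sum>\<beta> | length \<beta> = N. (p + (1 - p) * b) * (bernoulli_mass p \<beta> * b ^ count_list \<beta> False))"
    unfolding sum_bool_lists_Suc by (intro sum.cong) (auto simp: algebra_simps)
  then show ?case using Suc by (simp flip: sum_distrib_left)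
qed simp

text \<open>
  A digit 1 in the coordinate towards corner \<open>i\<close> leaves one letter, namely \<open>i\<close>; a digit 0 leaves the two
  others. So every digit 0 doubles the number of subtriangles in the slice.
\<close>
lemma card_words_with_bits:
  assumes "i < 3" "length \<beta> = N"
  shows "card {v \<in> words N. bits i v = \<beta>} = 2 ^ count_list \<beta> False"
  using assms(2)
proof (induction \<beta> arbitrary: N)
  case Nil
  then have "{v \<in> words N. bits i v = []} = {[]}" by (auto simp: words_def)
  then show ?case by simp
next
  case (Cons b \<beta>)
  define M where "M = length \<beta>"
  have N: "N = Suc M" using Cons.prems by (simp add: M_def)
  let ?D = "{d. d < 3 \<and> (d = i) = b}"
  have "{v \<in> words N. bits i v = b # \<beta>} = case_prod (#) ` (?D \<times> {v \<in> words M. bits i v = \<beta>})"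
    (is "?L = ?R")
  proof (intro equalityI subsetI)
    fix w assume w: "w \<in> ?L"
    then obtain d v where "w = d # v" by (cases w) (auto simp: words_def N)
    with w show "w \<in> ?R" by (auto simp: words_def N intro!: image_eqI[of _ _ "(d, v)"])
  qed (auto simp: words_def N)
  then have "card {v \<in> words N. bits i v = b # \<beta>} = card (?D \<times> {v \<in> words M. bits i v = \<beta>})"
    by (simp add: card_image inj_on_def)
  also have "\<dots> = card ?D * 2 ^ count_list \<beta> False"
    using Cons.IH[of M] by (simp add: card_cartesian_product M_def)
  also have "card ?D = (if b then 1 else 2)"
  proof (cases b)
    case True
    then have "?D = {i}" using assms(1) by auto
    then show ?thesis using True by simp
  next
    case False
    then have "?D = {..<3} - {i}" by auto
    then show ?thesis using False assms(1) by simp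
  qed
  finally show ?case by simp
qed

text \<open>
  Both sides are equal to 1 at \<open>\<theta> = 0\<close>, with derivatives \<open>(1 - p) * ln 2 < d * ln 2\<close>. This is
  where the threshold \<open>1 - p\<close> comes from.
\<close>
lemma exponent_beating_entropy:
  fixes p d :: real
  assumes "1 - p < d"
  obtains \<theta> where "0 < \<theta>" "\<theta> \<le> 1" "p + (1 - p) * 2 powr \<theta> < 2 powr (\<theta> * d)"
proof -
  let ?D = "\<lambda>\<theta>::real. 2 powr (\<theta> * d) - (p + (1 - p) * 2 powr \<theta>)"
  have "(?D has_real_derivative (d * ln 2 - (1 - p) * ln 2)) (at 0)"
    by (auto intro!: derivative_eq_intros)
  moreover have "0 < d * ln 2 - (1 - p) * ln (2::real)"
    using assms by (simp flip: left_diff_distrib)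
  ultimately obtain \<epsilon> where \<epsilon>: "0 < \<epsilon>" "\<And>h. 0 < h \<Longrightarrow> h < \<epsilon> \<Longrightarrow> ?D 0 < ?D (0 + h)"
    using DERIV_pos_inc_right[of ?D] by blast
  define \<theta> where "\<theta> = min (\<epsilon> / 2) 1"
  have "0 < \<theta>" "\<theta> \<le> 1" "\<theta> < \<epsilon>" using \<epsilon>(1) by (auto simp: \<theta>_def)
  then show ?thesis using that[of \<theta>] \<epsilon>(2)[of \<theta>] by simp
qed


section \<open>Terraced functions\<close>

definition terrace :: "real \<Rightarrow> nat \<Rightarrow> nat \<Rightarrow> real \<Rightarrow> real" where
  "terrace p n N y = staircase p N (2 ^ n * y) / 2 ^ n"

lemma terrace_near:
  assumes "0 \<le> p" "p \<le> 1"
  shows "\<bar>terrace p n N y - y\<bar> \<le> 1 / 2 ^ n"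
proof -
  have "terrace p n N y - y = (staircase p N (2 ^ n * y) - 2 ^ n * y) / 2 ^ n"
    by (simp add: terrace_def diff_divide_distrib)
  then have "\<bar>terrace p n N y - y\<bar> = \<bar>staircase p N (2 ^ n * y) - 2 ^ n * y\<bar> / 2 ^ n"
    by simp
  also have "\<dots> \<le> 1 / 2 ^ n"
    using staircase_near[OF assms, of N "2 ^ n * y"] by (intro divide_right_mono) auto
  finally show ?thesis .
qed

lemma terrace_holder:
  assumes "0 < \<alpha>" "\<alpha> < 1" "p = 2 powr (- \<alpha>)" "2 ^ n * \<bar>x - y\<bar> \<le> 1"
  shows "\<bar>terrace p n N x - terrace p n N y\<bar> \<le> 16 * (2 ^ n * \<bar>x - y\<bar>) powr \<alpha> / 2 ^ n"
proof -
  have eq: "\<bar>2 ^ n * x - 2 ^ n * y\<bar> = 2 ^ n * \<bar>x - y\<bar>"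
    by (simp add: abs_mult flip: right_diff_distrib)
  have "\<bar>terrace p n N x - terrace p n N y\<bar> = \<bar>staircase p N (2 ^ n * x) - staircase p N (2 ^ n * y)\<bar> / 2 ^ n"
    by (simp add: terrace_def flip: diff_divide_distrib)
  also have "\<dots> \<le> 16 * \<bar>2 ^ n * x - 2 ^ n * y\<bar> powr \<alpha> / 2 ^ n"
    using staircase_holder[OF assms(1-3), of "2 ^ n * x" "2 ^ n * y" N] assms(4)
    by (intro divide_right_mono) (auto simp: eq)
  finally show ?thesis by (simp add: eq)
qed

text \<open>
  Along an address \<open>u @ b # v\<close> the first \<open>n\<close> digits \<open>u\<close> select a cell, the digit \<open>b\<close> decides between its flat and
  its climbing half, and in the climbing half the digits \<open>v\<close> are those of the Bernoulli measure.
\<close>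
lemma terrace_on_cylinder:
  assumes u: "length u = n" and v: "length v = N" and \<sigma>: "0 \<le> \<sigma>" "\<sigma> \<le> 1"
  shows "terrace p n N (binary_value (u @ b # v) + \<sigma> / 2 ^ (n + 1 + N)) =
    binary_value u + (if b then bernoulli_cdf p N (binary_value v) + \<sigma> * bernoulli_mass p v else 0) / 2 ^ n"
proof -
  define z where "z = binary_value v + \<sigma> / 2 ^ N"
  define y where "y = (of_bool b + z) / 2"
  have "\<sigma> / 2 ^ N \<le> 1 / 2 ^ N" "0 \<le> \<sigma> / 2 ^ N" using \<sigma> by (auto intro: divide_right_mono)
  then have z: "0 \<le> z" "z \<le> 1" using binary_value_bounds(1)[of v] binary_value_bounds(2)[of v, unfolded v] unfolding z_def by linarith+
  have y: "0 \<le> y" "y \<le> 1" using z by (auto simp: y_def)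
  obtain k :: int where k: "2 ^ n * binary_value u = of_int k"
    using binary_value_scaled_Ints[of u] u by (auto elim: Ints_cases)
  have "2 ^ n * (binary_value (u @ b # v) + \<sigma> / 2 ^ (n + 1 + N)) = 2 ^ n * binary_value u + y"
    by (simp add: binary_value_append u y_def z_def power_add field_simps)
  then have "staircase p N (2 ^ n * (binary_value (u @ b # v) + \<sigma> / 2 ^ (n + 1 + N))) =
      2 ^ n * binary_value u + corner_ramp p N y"
    using staircase_on_cell[OF y, of p N k] by (simp add: k)
  moreover have "corner_ramp p N y = (if b then bernoulli_cdf p N z else 0)"
  proof (cases "b \<and> z \<noteq> 0")
    case True
    then have "2 * y - 1 = z" "1 / 2 < y" using z by (auto simp: y_def field_simps)
    then show ?thesis using True by (simp add: corner_ramp_def)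
  next
    case False
    then show ?thesis using z by (auto simp: corner_ramp_def y_def)
  qed
  moreover have "bernoulli_cdf p N z = bernoulli_cdf p N (binary_value v) + \<sigma> * bernoulli_mass p v"
    unfolding z_def using v \<sigma> by (rule bernoulli_cdf_affine_on_cylinder)
  ultimately show ?thesis by (simp add: terrace_def add_divide_distrib)
qed

text \<open>
  The vectors \<open>e'\<close> and \<open>f'\<close> are dual to \<open>e\<close> and \<open>f\<close>, so the inner products are the affine coordinates of \<open>x\<close>.
\<close>
definition terraced ::
  "('a::real_inner \<Rightarrow> real) \<Rightarrow> 'a \<Rightarrow> 'a \<Rightarrow> 'a \<Rightarrow> 'a \<Rightarrow> 'a \<Rightarrow> real \<Rightarrow> nat \<Rightarrow> nat \<Rightarrow> 'a \<Rightarrow> real" where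
  "terraced k a e f e' f' p n N x =
     k (affine_point a e f (terrace p n N ((x - a) \<bullet> e')) (terrace p n N ((x - a) \<bullet> f')))"

text \<open>
  A slice is given by the address \<open>u\<close> of a triangle of level \<open>n\<close>, a corner \<open>i\<close> of that triangle, and the
  digits \<open>\<beta>\<close> of the coordinate towards this corner; the value is the one at the lower end of the slice.
  Triangles of the same slice share this value, so all of them together contribute one interval of
  values.
\<close>
definition slice_value ::
  "('a::real_vector \<Rightarrow> real) \<Rightarrow> 'a \<Rightarrow> 'a \<Rightarrow> 'a \<Rightarrow> real \<Rightarrow> nat \<Rightarrow> nat \<Rightarrow> nat list \<times> nat \<times> bool list \<Rightarrow> real" where
  "slice_value k a e f p n N = (\<lambda>(u, i, \<beta>). k (affine_point a e f
     (binary_value (bits 1 u) + (if i = 1 then bernoulli_cdf p N (binary_value \<beta>) else 0) / 2 ^ n)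
     (binary_value (bits 2 u) + (if i = 2 then bernoulli_cdf p N (binary_value \<beta>) else 0) / 2 ^ n)))"

lemma dist_affine_point:
  assumes "norm e \<le> 1" "norm f \<le> 1"
  shows "dist (affine_point a e f s t) (affine_point a e f s' t') \<le> \<bar>s - s'\<bar> + \<bar>t - t'\<bar>"
proof -
  have "affine_point a e f s t - affine_point a e f s' t' = (s - s') *\<^sub>R e + (t - t') *\<^sub>R f"
    by (simp add: affine_point_def algebra_simps)
  then have "dist (affine_point a e f s t) (affine_point a e f s' t') \<le> \<bar>s - s'\<bar> * norm e + \<bar>t - t'\<bar> * norm f"
    unfolding dist_norm by (metis norm_triangle_ineq norm_scaleR)
  also have "\<dots> \<le> \<bar>s - s'\<bar> * 1 + \<bar>t - t'\<bar> * 1"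
    using assms by (intro add_mono mult_left_mono) auto
  finally show ?thesis by simp
qed

locale affine_frame =
  fixes a e f e' f' :: "'a::euclidean_space"
  assumes norms: "norm e \<le> 1" "norm f \<le> 1" "norm e' \<le> 2" "norm f' \<le> 2"
    and dual: "e \<bullet> e' = 1" "e \<bullet> f' = 0" "f \<bullet> e' = 0" "f \<bullet> f' = 1"
begin

lemma coordinates_affine_point:
  "(affine_point a e f s t - a) \<bullet> e' = s" "(affine_point a e f s t - a) \<bullet> f' = t"
  using dual by (auto simp: affine_point_def inner_add_left)

lemma coordinates_lipschitz:
  assumes "g \<in> {e', f'}"
  shows "\<bar>(x - a) \<bullet> g - (y - a) \<bullet> g\<bar> \<le> 2 * dist x y"
proof -
  have "(x - a) \<bullet> g - (y - a) \<bullet> g = (x - y) \<bullet> g" by (simp add: inner_diff_left)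
  also have "\<bar>(x - y) \<bullet> g\<bar> \<le> norm (x - y) * norm g" by (rule Cauchy_Schwarz_ineq2)
  also have "\<dots> \<le> norm (x - y) * 2" using assms norms by (intro mult_left_mono) auto
  finally show ?thesis by (simp add: dist_norm mult.commute)
qed

lemma terraced_near:
  assumes p: "0 \<le> p" "p \<le> 1" and L: "0 \<le> L" "\<And>x y. \<bar>k x - k y\<bar> \<le> L * dist x y"
    and x: "x = affine_point a e f s t"
  shows "\<bar>terraced k a e f e' f' p n N x - k x\<bar> \<le> 2 * L / 2 ^ n"
proof -
  have "\<bar>terraced k a e f e' f' p n N x - k x\<bar> \<le>
      L * dist (affine_point a e f (terrace p n N s) (terrace p n N t)) (affine_point a e f s t)"
    unfolding terraced_def x coordinates_affine_point by (rule L(2))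
  also have "\<dots> \<le> L * (1 / 2 ^ n + 1 / 2 ^ n)"
    using terrace_near[OF p, of n N s] terrace_near[OF p, of n N t] L(1)
    by (intro mult_left_mono order_trans[OF dist_affine_point[OF norms(1,2)]] add_mono) auto
  finally show ?thesis by (simp add: mult.commute)
qed

text \<open>
  At distances below the cell size the Lipschitz bound of \<open>k\<close> and the Hoelder bound of the staircase
  combine to a Hoelder bound with a constant that tends to 0 as \<open>n\<close> grows because \<open>\<alpha> < 1\<close>.
\<close>
lemma terraced_holder_local:
  assumes \<alpha>: "0 < \<alpha>" "\<alpha> < 1" "p = 2 powr (- \<alpha>)" and L: "0 \<le> L" "\<And>x y. \<bar>k x - k y\<bar> \<le> L * dist x y"
    and close: "2 ^ n * (2 * dist x y) \<le> 1"
  shows "\<bar>terraced k a e f e' f' p n N x - terraced k a e f e' f' p n N y\<bar>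
           \<le> 64 * L * (2 ^ n) powr (\<alpha> - 1) * dist x y powr \<alpha>"
proof -
  have step: "\<bar>terrace p n N ((x - a) \<bullet> g) - terrace p n N ((y - a) \<bullet> g)\<bar>
      \<le> 32 * (2 ^ n) powr (\<alpha> - 1) * dist x y powr \<alpha>" if g: "g \<in> {e', f'}" for g
  proof -
    note lip = coordinates_lipschitz[OF g, of x y]
    have "2 ^ n * \<bar>(x - a) \<bullet> g - (y - a) \<bullet> g\<bar> \<le> 2 ^ n * (2 * dist x y)"
      using lip by (intro mult_left_mono) auto
    then have near: "2 ^ n * \<bar>(x - a) \<bullet> g - (y - a) \<bullet> g\<bar> \<le> 2 * (2 ^ n * dist x y)"
      and "2 ^ n * \<bar>(x - a) \<bullet> g - (y - a) \<bullet> g\<bar> \<le> 1"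
      using close by linarith+
    then have "\<bar>terrace p n N ((x - a) \<bullet> g) - terrace p n N ((y - a) \<bullet> g)\<bar>
        \<le> 16 * (2 ^ n * \<bar>(x - a) \<bullet> g - (y - a) \<bullet> g\<bar>) powr \<alpha> / 2 ^ n"
      by (intro terrace_holder[OF \<alpha>])
    also have "\<dots> \<le> 16 * (2 * (2 ^ n * dist x y)) powr \<alpha> / 2 ^ n"
      using near \<alpha> by (intro divide_right_mono mult_left_mono powr_mono2) auto
    also have "\<dots> \<le> 16 * (2 * (2 ^ n * dist x y) powr \<alpha>) / 2 ^ n"
      using powr_double_le[OF \<alpha>, of "2 ^ n * dist x y"] by (intro divide_right_mono mult_left_mono) auto
    also have "\<dots> = 32 * (2 ^ n) powr (\<alpha> - 1) * dist x y powr \<alpha>"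
      by (simp add: powr_mult powr_diff)
    finally show ?thesis .
  qed
  have "\<bar>terraced k a e f e' f' p n N x - terraced k a e f e' f' p n N y\<bar> \<le>
      L * dist (affine_point a e f (terrace p n N ((x - a) \<bullet> e')) (terrace p n N ((x - a) \<bullet> f')))
               (affine_point a e f (terrace p n N ((y - a) \<bullet> e')) (terrace p n N ((y - a) \<bullet> f')))"
    unfolding terraced_def by (rule L(2))
  also have "\<dots> \<le> L * (32 * (2 ^ n) powr (\<alpha> - 1) * dist x y powr \<alpha> + 32 * (2 ^ n) powr (\<alpha> - 1) * dist x y powr \<alpha>)"
    using L(1) by (intro mult_left_mono order_trans[OF dist_affine_point[OF norms(1,2)]] add_mono step) auto
  finally show ?thesis by (simp add: algebra_simps)
qed

text \<open>
  Close points are handled by the local estimate. For points at distance of order at least \<open>2 ^ -n\<close> the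
  Hoelder bound of \<open>k\<close> has a reserve of \<open>(1 - c) * dist x y powr \<alpha>\<close>, of order at least
  \<open>2 powr (-\<alpha> * n)\<close>, which for large \<open>n\<close> exceeds the displacement error of order \<open>L / 2 ^ n\<close>.
\<close>
lemma terraced_holder:
  assumes \<alpha>: "0 < \<alpha>" "\<alpha> < 1" "p = 2 powr (- \<alpha>)" and L: "0 \<le> L" "\<And>x y. \<bar>k x - k y\<bar> \<le> L * dist x y"
    and c: "0 < c" "c < 1" "\<And>x y. \<bar>k x - k y\<bar> \<le> c * dist x y powr \<alpha>"
    and n: "64 * L \<le> (2 ^ n) powr (1 - \<alpha>)" "8 * L \<le> (1 - c) * (2 ^ n) powr (1 - \<alpha>)"
    and F: "\<And>x. x \<in> F \<Longrightarrow> \<exists>s t. x = affine_point a e f s t"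
  shows "holder_on 1 \<alpha> F (terraced k a e f e' f' p n N)"
  unfolding holder_on_def
proof (intro ballI)
  fix x y assume xy: "x \<in> F" "y \<in> F"
  let ?g = "terraced k a e f e' f' p n N"
  note p = heavy_mass_bounds[OF \<alpha>]
  have inv: "(2 ^ n) powr (\<alpha> - 1) * (2 ^ n) powr (1 - \<alpha>) = (1::real)"
    by (simp flip: powr_add)
  show "\<bar>?g x - ?g y\<bar> \<le> 1 * dist x y powr \<alpha>"
  proof (cases "2 ^ n * (2 * dist x y) \<le> 1")
    case True
    have "(2 ^ n) powr (\<alpha> - 1) * (64 * L) \<le> (2 ^ n) powr (\<alpha> - 1) * (2 ^ n) powr (1 - \<alpha>)"
      using n(1) by (intro mult_left_mono) auto
    then have "64 * L * (2 ^ n) powr (\<alpha> - 1) \<le> 1" unfolding inv by (simp only: mult_ac)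
    then have "64 * L * (2 ^ n) powr (\<alpha> - 1) * dist x y powr \<alpha> \<le> 1 * dist x y powr \<alpha>"
      by (intro mult_right_mono) auto
    then show ?thesis using terraced_holder_local[OF \<alpha> L True, of N] by linarith
  next
    case False
    obtain s t s' t' where "x = affine_point a e f s t" "y = affine_point a e f s' t'"
      using F xy by meson
    then have near: "\<bar>?g x - k x\<bar> \<le> 2 * L / 2 ^ n" "\<bar>?g y - k y\<bar> \<le> 2 * L / 2 ^ n"
      using terraced_near[OF p(3,4) L] by blast+
    have "1 \<le> (2 * (2 ^ n * dist x y)) powr \<alpha>"
      using False \<alpha> by (intro ge_one_powr_ge_zero) auto
    also have "\<dots> \<le> 2 * (2 ^ n * dist x y) powr \<alpha>"
      by (rule powr_double_le[OF \<alpha>]) auto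
    finally have far: "1 \<le> 2 * ((2 ^ n) powr \<alpha> * dist x y powr \<alpha>)" by (simp add: powr_mult)
    have "8 * L / 2 ^ n \<le> (1 - c) * (2 ^ n) powr (1 - \<alpha>) / 2 ^ n"
      using n(2) by (intro divide_right_mono) auto
    also have "\<dots> = (1 - c) * (2 ^ n) powr (- \<alpha>)"
      by (simp add: powr_diff powr_minus field_simps)
    also have "\<dots> = (1 - c) * (2 ^ n) powr (- \<alpha>) * 1" by simp
    also have "\<dots> \<le> (1 - c) * (2 ^ n) powr (- \<alpha>) * (2 * ((2 ^ n) powr \<alpha> * dist x y powr \<alpha>))"
      using c far by (intro mult_left_mono) auto
    also have "\<dots> = 2 * ((1 - c) * dist x y powr \<alpha>)"
      by (simp add: powr_minus)
    finally have "4 * L / 2 ^ n \<le> (1 - c) * dist x y powr \<alpha>" by simp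
    moreover have "(1 - c) * dist x y powr \<alpha> + c * dist x y powr \<alpha> = dist x y powr \<alpha>"
      by (simp add: algebra_simps)
    ultimately show ?thesis using near c(3)[of x y] by linarith
  qed
qed

text \<open>
  Within the cell the staircase maps both coordinates to constants, except the one towards corner \<open>i\<close>, whose
  image varies by the Bernoulli mass of the digits that follow, scaled by \<open>2 ^ -n\<close>.
\<close>
lemma terraced_on_cell:
  assumes L: "0 \<le> L" "\<And>x y. \<bar>k x - k y\<bar> \<le> L * dist x y" and p: "0 \<le> p" "p \<le> 1"
    and u: "length u = n" and v: "length v = N" and x: "x \<in> cell a e f (u @ i # v)"
  shows "\<bar>terraced k a e f e' f' p n N x - slice_value k a e f p n N (u, i, bits i v)\<bar>
           \<le> L * bernoulli_mass p (bits i v) / 2 ^ n"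
proof -
  obtain \<sigma> \<tau> where st: "0 \<le> \<sigma>" "0 \<le> \<tau>" "\<sigma> + \<tau> \<le> 1"
    and x: "x = affine_point a e f (binary_value (bits 1 (u @ i # v)) + \<sigma> / 2 ^ (n + 1 + N))
        (binary_value (bits 2 (u @ i # v)) + \<tau> / 2 ^ (n + 1 + N))"
    using x unfolding cell_def by (auto simp: u v)
  let ?m = "bernoulli_mass p (bits i v)" and ?\<phi> = "bernoulli_cdf p N (binary_value (bits i v))"
  have m: "0 \<le> ?m" using p by (rule bernoulli_mass_nonneg)
  have ter: "terrace p n N (binary_value (bits j (u @ i # v)) + \<rho> / 2 ^ (n + 1 + N)) =
      binary_value (bits j u) + (if i = j then ?\<phi> + \<rho> * ?m else 0) / 2 ^ n" if "0 \<le> \<rho>" "\<rho> \<le> 1" for j \<rho>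
    using terrace_on_cylinder[of "bits j u" n "bits j v" N \<rho> p "i = j"] that u v by simp
  have "\<bar>terraced k a e f e' f' p n N x - slice_value k a e f p n N (u, i, bits i v)\<bar> \<le>
     L * dist (affine_point a e f (binary_value (bits 1 u) + (if i = 1 then ?\<phi> + \<sigma> * ?m else 0) / 2 ^ n)
                 (binary_value (bits 2 u) + (if i = 2 then ?\<phi> + \<tau> * ?m else 0) / 2 ^ n))
              (affine_point a e f (binary_value (bits 1 u) + (if i = 1 then ?\<phi> else 0) / 2 ^ n)
                 (binary_value (bits 2 u) + (if i = 2 then ?\<phi> else 0) / 2 ^ n))"
    unfolding terraced_def x coordinates_affine_point slice_value_def prod.case
    using st by (subst (1 2) ter) (auto intro!: L(2))
  also have "\<dots> \<le> L * (?m / 2 ^ n)"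
  proof (intro mult_left_mono L(1) order_trans[OF dist_affine_point[OF norms(1,2)]])
    have "\<sigma> * ?m \<le> 1 * ?m" "\<tau> * ?m \<le> 1 * ?m" using st m by (intro mult_right_mono; simp)+
    then show "\<bar>binary_value (bits 1 u) + (if i = 1 then ?\<phi> + \<sigma> * ?m else 0) / 2 ^ n -
        (binary_value (bits 1 u) + (if i = 1 then ?\<phi> else 0) / 2 ^ n)\<bar> +
      \<bar>binary_value (bits 2 u) + (if i = 2 then ?\<phi> + \<tau> * ?m else 0) / 2 ^ n -
        (binary_value (bits 2 u) + (if i = 2 then ?\<phi> else 0) / 2 ^ n)\<bar> \<le> ?m / 2 ^ n"
      using st m by (auto simp: add_divide_distrib divide_right_mono)
  qed
  finally show ?thesis by simp
qed

text \<open>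
  Group the triangles of level \<open>n + 1 + N\<close> into slices. The values taken on a slice lie in an interval of
  length proportional to a Bernoulli mass, and the slice contains a power of two of triangles.
  The number of triangles met by a level, raised to the power \<open>\<theta> \<le> 1\<close>, is at most the sum of the same
  powers over the slices, whose integral over all levels is \<open>K * A ^ N\<close> up to the slack \<open>\<delta>\<close>.
  Outside a small set of levels it is thus at most \<open>\<Lambda>\<close>.
\<close>
lemma terraced_thin_levels:
  assumes p: "0 < p" "p < 1" and d: "1 - p < d" and L: "0 < L" "\<And>x y. \<bar>k x - k y\<bar> \<le> L * dist x y"
    and \<eta>: "0 < \<eta>" and cells: "\<And>M x. x \<in> F \<Longrightarrow> \<exists>w\<in>words M. x \<in> cell a e f w"
  shows "\<exists>N. \<exists>\<delta>>0. thin_levels_near F d \<eta> (terraced k a e f e' f' p n N) \<delta>"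
proof -
  have d0: "0 < d" using p d by linarith
  obtain \<theta> where \<theta>: "0 < \<theta>" "\<theta> \<le> 1" and beat: "p + (1 - p) * 2 powr \<theta> < 2 powr (\<theta> * d)"
    using exponent_beating_entropy[OF d] by blast
  define A where "A = p + (1 - p) * 2 powr \<theta>"
  define B where "B = (2::real) powr (\<theta> * d)"
  define K where "K = 2 * L * 3 ^ (n + 1) / 2 ^ n"
  have K: "0 < K" using L by (simp add: K_def)
  have AB: "0 < A" "A < B" using p beat by (auto simp: A_def B_def intro: add_pos_nonneg)
  then have "(\<lambda>N. (A / B) ^ N) \<longlonglongrightarrow> 0" by (intro LIMSEQ_realpow_zero) auto
  then have "\<forall>\<^sub>F N in sequentially. (A / B) ^ N < \<eta> powr \<theta> * \<eta> / K"
    using K \<eta> by (intro order_tendstoD) auto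
  moreover have "\<forall>\<^sub>F N in sequentially. (1 / 2 :: real) ^ N < \<eta>"
    using \<eta> by (intro order_tendstoD(2)[OF LIMSEQ_realpow_zero]) auto
  ultimately have "\<forall>\<^sub>F N in sequentially. (A / B) ^ N < \<eta> powr \<theta> * \<eta> / K \<and> (1 / 2) ^ N < \<eta>"
    by (rule eventually_conj)
  then obtain N where N: "(A / B) ^ N < \<eta> powr \<theta> * \<eta> / K" "(1 / 2) ^ N < \<eta>"
    by (auto simp: eventually_sequentially)
  \<comment> \<open>Chosen so that a level meeting at most \<open>\<Lambda> powr (1 / \<theta>)\<close> triangles has premeasure at most \<open>\<eta>\<close>.\<close>
  define \<Lambda> where "\<Lambda> = \<eta> powr \<theta> * B ^ N"
  have lam: "0 < \<Lambda>" using \<eta> AB by (simp add: \<Lambda>_def)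
  have lam_root: "\<Lambda> powr (1 / \<theta>) = \<eta> * 2 powr (d * N)"
    using \<theta> \<eta> by (simp add: \<Lambda>_def B_def powr_mult powr_powr powr_power mult.commute)
  have lam_big: "K * A ^ N < \<Lambda> * \<eta>"
    using N(1) K AB by (simp add: \<Lambda>_def power_divide field_simps)

  define G where "G = words n \<times> {..<3::nat} \<times> {\<beta> :: bool list. length \<beta> = N}"
  define ctr where "ctr = slice_value k a e f p n N"
  define rad where "rad = (\<lambda>(u :: nat list, i :: nat, \<beta>). L * bernoulli_mass p \<beta> / 2 ^ n)"
  define num where "num = (\<lambda>(u :: nat list, i :: nat, \<beta>). (2::real) ^ count_list \<beta> False)"
  have finG: "finite G" by (auto simp: G_def)
  have mass: "0 \<le> bernoulli_mass p \<beta>" for \<beta> using p by (intro bernoulli_mass_nonneg) auto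
  have total: "(\<Sum>\<gamma>\<in>G. 2 * rad \<gamma> * num \<gamma> powr \<theta>) = K * A ^ N"
  proof -
    let ?t = "\<lambda>\<beta>. (2 * L / 2 ^ n) * (bernoulli_mass p \<beta> * (2 powr \<theta>) ^ count_list \<beta> False)"
    have pow: "((2::real) ^ m) powr \<theta> = (2 powr \<theta>) ^ m" for m
      by (simp add: powr_powr powr_power mult.commute flip: powr_realpow)
    have "(\<Sum>\<gamma>\<in>G. 2 * rad \<gamma> * num \<gamma> powr \<theta>) =
        (\<Sum>(u, \<gamma>)\<in>words n \<times> ({..<3::nat} \<times> {\<beta>. length \<beta> = N}). case \<gamma> of (i, \<beta>) \<Rightarrow> ?t \<beta>)"
      unfolding G_def by (intro sum.cong) (auto simp: rad_def num_def pow)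
    also have "\<dots> = (\<Sum>u\<in>words n. \<Sum>i\<in>{..<3::nat}. \<Sum>\<beta> | length \<beta> = N. ?t \<beta>)"
      by (simp only: sum.cartesian_product[symmetric])
    also have "\<dots> = 3 ^ n * (3 * ((2 * L / 2 ^ n) * A ^ N))"
      unfolding sum_distrib_left[symmetric] sum_bernoulli_mass_times_power by (simp add: card_words A_def)
    finally show ?thesis by (simp add: K_def)
  qed
  obtain \<delta> E where \<delta>: "0 < \<delta>" and E: "E \<in> sets lborel" "emeasure lborel E \<le> ennreal \<eta>"
    and few: "\<And>r. r \<notin> E \<Longrightarrow> (\<Sum>\<gamma>\<in>{\<gamma>\<in>G. \<bar>r - ctr \<gamma>\<bar> \<le> rad \<gamma> + \<delta>}. num \<gamma> powr \<theta>) \<le> \<Lambda>"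
  proof (rule weighted_interval_multiplicity[OF finG _ _ lam, where w = "\<lambda>\<gamma>. num \<gamma> powr \<theta>" and \<rho> = rad and \<eta> = \<eta> and c = ctr])
    show "0 \<le> rad \<gamma>" for \<gamma> using L(1) mass by (auto simp: rad_def split: prod.split)
    show "(\<Sum>\<gamma>\<in>G. 2 * rad \<gamma> * num \<gamma> powr \<theta>) < \<Lambda> * \<eta>" using total lam_big by simp
  qed auto

  have "hausdorff_premeasure d \<eta> {x \<in> F. h x = r} \<le> ennreal \<eta>"
    if h: "\<forall>x\<in>F. \<bar>h x - terraced k a e f e' f' p n N x\<bar> \<le> \<delta>" and r: "r \<notin> E" for h r
  proof -
    define H where "H = {\<gamma>\<in>G. \<bar>r - ctr \<gamma>\<bar> \<le> rad \<gamma> + \<delta>}"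
    \<comment> \<open>All triangles contained in those slices whose enlarged interval of values contains \<open>r\<close>.\<close>
    define I where "I = (SIGMA \<gamma>:H. {v\<in>words N. bits (fst (snd \<gamma>)) v = snd (snd \<gamma>)})"
    define V where "V = (\<lambda>((u, i, \<beta> :: bool list), v). cell a e f (u @ i # v))"
    have finH: "finite H" using finG by (simp add: H_def)
    have finI: "finite I" using finH by (auto simp: I_def)
    have "card I = (\<Sum>\<gamma>\<in>H. card {v\<in>words N. bits (fst (snd \<gamma>)) v = snd (snd \<gamma>)})"
      unfolding I_def using finH by (intro card_SigmaI) auto
    also have "\<dots> = (\<Sum>\<gamma>\<in>H. 2 ^ count_list (snd (snd \<gamma>)) False)"
      by (intro sum.cong refl card_words_with_bits) (auto simp: H_def G_def)
    finally have cardI: "real (card I) = (\<Sum>\<gamma>\<in>H. num \<gamma>)"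
      by (simp add: num_def split_def)
    have "real (card I) powr \<theta> \<le> (\<Sum>\<gamma>\<in>H. num \<gamma> powr \<theta>)"
      unfolding cardI using \<theta> finH by (intro powr_sum_le) (auto simp: num_def)
    also have "\<dots> \<le> \<Lambda>" unfolding H_def by (rule few[OF r])
    finally have "(real (card I) powr \<theta>) powr (1 / \<theta>) \<le> \<Lambda> powr (1 / \<theta>)"
      using \<theta> by (intro powr_mono2) auto
    then have card_le: "real (card I) \<le> \<eta> * 2 powr (d * N)"
      using \<theta> by (simp add: powr_powr lam_root)
    have len: "length (fst (fst c) @ fst (snd (fst c)) # snd c) = n + 1 + N" if "c \<in> I" for c
      using that by (auto simp: I_def H_def G_def words_def)
    have cover: "{x \<in> F. h x = r} \<subseteq> (\<Union>c\<in>I. V c)"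
    proof safe
      fix x assume x: "x \<in> F" "r = h x"
      obtain w where w: "w \<in> words (n + 1 + N)" "x \<in> cell a e f w"
        using cells[OF x(1)] by blast
      define u i v where "u = take n w" and "i = w ! n" and "v = drop (Suc n) w"
      have wuv: "w = u @ i # v"
        using w unfolding u_def i_def v_def words_def by (simp add: id_take_nth_drop)
      have lens: "length u = n" "length v = N"
        using w by (auto simp: u_def v_def words_def)
      have mem: "u \<in> words n" "i < 3" "v \<in> words N"
        using w(1) lens unfolding wuv words_def by auto
      have "\<bar>terraced k a e f e' f' p n N x - ctr (u, i, bits i v)\<bar> \<le> rad (u, i, bits i v)"
        unfolding ctr_def rad_def prod.case using L p w lens
        by (intro terraced_on_cell) (auto simp: wuv)
      moreover have "\<bar>h x - terraced k a e f e' f' p n N x\<bar> \<le> \<delta>" using h x by blast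
      ultimately have "(u, i, bits i v) \<in> H"
        using mem lens x(2) unfolding H_def G_def by auto
      then have "((u, i, bits i v), v) \<in> I" using mem by (auto simp: I_def)
      moreover have "x \<in> V ((u, i, bits i v), v)" using w by (simp add: V_def wuv)
      ultimately show "x \<in> (\<Union>c\<in>I. V c)" by blast
    qed
    have V: "bounded (V c)" "diameter (V c) \<le> (1 / 2) ^ (n + N)" if "c \<in> I" for c
      using cell_diameter[OF norms(1,2), of a "fst (fst c) @ fst (snd (fst c)) # snd c"] len[OF that]
      by (auto simp: V_def split_def power_one_over)
    have "(1 / 2 :: real) ^ (n + N) \<le> (1 / 2) ^ N" by (rule power_decreasing) auto
    then have small: "(1 / 2 :: real) ^ (n + N) \<le> \<eta>" using N(2) by linarith
    have "hausdorff_premeasure d \<eta> {x \<in> F. h x = r} \<le> ennreal (real (card I) * ((1 / 2) ^ (n + N)) powr d)"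
      using V small d0 by (intro hausdorff_premeasure_finite_cover[OF finI cover]) auto
    also have "\<dots> \<le> ennreal \<eta>"
    proof (rule ennreal_leI)
      have "((1 / 2) ^ (n + N)) powr d \<le> ((1 / 2 :: real) ^ N) powr d"
        using d0 by (intro powr_mono2 power_decreasing) auto
      then have "real (card I) * ((1 / 2) ^ (n + N)) powr d \<le> (\<eta> * 2 powr (d * N)) * ((1 / 2) ^ N) powr d"
        using card_le \<eta> by (intro mult_mono) auto
      also have "((1 / 2 :: real) ^ N) powr d = 2 powr (- (d * N))"
        by (simp add: powr_powr powr_minus power_one_over inverse_eq_divide powr_divide mult.commute flip: powr_realpow)
      also have "\<eta> * 2 powr (d * N) * 2 powr (- (d * N)) = \<eta>"
        by (simp add: powr_minus)
      finally show "real (card I) * ((1 / 2) ^ (n + N)) powr d \<le> \<eta>" .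
    qed
    finally show ?thesis .
  qed
  then have "thin_levels_near F d \<eta> (terraced k a e f e' f' p n N) \<delta>"
    unfolding thin_levels_near_def using E by blast
  then show ?thesis using \<delta> by blast
qed

end


text \<open>
  The Gram matrix of two sides of a unit equilateral triangle has entries 1 and \<open>1 / 2\<close>; its inverse has
  entries \<open>4 / 3\<close> and \<open>- 2 / 3\<close>, which are the coefficients of the dual basis.
\<close>
lemma equilateral_affine_frame:
  fixes a b c :: "'a::euclidean_space"
  assumes "dist a b = 1" "dist b c = 1" "dist a c = 1"
  obtains e' f' where "affine_frame (b - a) (c - a) e' f'"
proof -
  let ?e = "b - a" and ?f = "c - a"
  have e: "norm ?e = 1" and f: "norm ?f = 1" and ef: "norm (?e - ?f) = 1"
    using assms by (auto simp: dist_norm norm_minus_commute)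
  have ee: "?e \<bullet> ?e = 1" "?f \<bullet> ?f = 1" using e f by (auto simp: norm_eq_1)
  have "(?e - ?f) \<bullet> (?e - ?f) = 1" using ef unfolding norm_eq_1 .
  then have half: "?e \<bullet> ?f = 1 / 2" "?f \<bullet> ?e = 1 / 2"
    unfolding inner_diff_left[of ?e] inner_diff_right[of _ ?e] ee by (simp_all add: inner_commute)
  define e' where "e' = (4 / 3) *\<^sub>R ?e - (2 / 3) *\<^sub>R ?f"
  define f' where "f' = (4 / 3) *\<^sub>R ?f - (2 / 3) *\<^sub>R ?e"
  have "affine_frame ?e ?f e' f'"
  proof
    show "norm ?e \<le> 1" "norm ?f \<le> 1" using e f by auto
    show "norm e' \<le> 2" unfolding e'_def
      by (rule order_trans[OF norm_triangle_ineq4]) (use e f in \<open>simp del: norm_minus_commute\<close>)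
    show "norm f' \<le> 2" unfolding f'_def
      by (rule order_trans[OF norm_triangle_ineq4]) (use e f in \<open>simp del: norm_minus_commute\<close>)
    show "?e \<bullet> e' = 1" "?e \<bullet> f' = 0" "?f \<bullet> e' = 0" "?f \<bullet> f' = 1"
      unfolding e'_def f'_def inner_diff_right[of _ "_ *\<^sub>R _"] inner_scaleR_right half ee by simp_all
  qed
  then show ?thesis by (rule that)
qed

section \<open>Density of thin levels and the bound\<close>

lemma thin_levels_near_cong:
  assumes "\<And>x. x \<in> F \<Longrightarrow> g x = g' x"
  shows "thin_levels_near F d \<eta> g \<delta> = thin_levels_near F d \<eta> g' \<delta>"
  unfolding thin_levels_near_def using assms by (simp cong: ball_cong)

context affine_frame
begin

text \<open>
  Scaling \<open>q\<close> by \<open>c < 1\<close> creates room in the Hoelder condition, at a uniform cost of \<open>(1 - c) * B\<close>. Next \<open>n\<close> is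
  fixed in terms of \<open>L\<close>, \<open>c\<close> and \<open>\<epsilon>\<close>, and only then the number \<open>N\<close> of Bernoulli digits is chosen large. This
  order is possible because the Hoelder bounds do not depend on \<open>N\<close>.
\<close>
lemma thin_levels_dense:
  assumes \<alpha>: "0 < \<alpha>" "\<alpha> < 1" and d: "1 - 2 powr (- \<alpha>) < d"
    and F: "F \<noteq> {}" "bounded F" and cells: "\<And>M x. x \<in> F \<Longrightarrow> \<exists>w\<in>words M. x \<in> cell a e f w"
    and q: "q \<in> mspace (holder_space \<alpha> F)" and \<epsilon>: "0 < \<epsilon>" and \<eta>: "0 < \<eta>"
  shows "\<exists>g\<in>mspace (holder_space \<alpha> F). \<exists>\<delta>>0. (\<forall>x\<in>F. \<bar>q x - g x\<bar> \<le> \<epsilon>) \<and> thin_levels_near F d \<eta> g \<delta>"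
proof -
  have holder_q: "holder_on 1 \<alpha> F q"
    using q F \<alpha> by (simp add: mspace_holder_space)
  have "bounded (q ` F)"
    using q by (simp add: holder_space_def Met_TC.fspace_def)
  then obtain B where B: "0 < B" "\<And>x. x \<in> F \<Longrightarrow> \<bar>q x\<bar> \<le> B"
    by (auto simp: bounded_pos)
  define p where "p = 2 powr (- \<alpha>)"
  note p = heavy_mass_bounds[OF \<alpha> p_def]
  define \<kappa> where "\<kappa> = min (1 / 2) (\<epsilon> / (4 * B))"
  define c where "c = 1 - \<kappa>"
  have \<kappa>: "0 < \<kappa>" "\<kappa> \<le> 1 / 2" "\<kappa> * B \<le> \<epsilon> / 4"
    using \<epsilon> B by (auto simp: \<kappa>_def min_def field_simps)
  have c: "0 < c" "c < 1" using \<kappa> by (auto simp: c_def)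
  have holder_cq: "holder_on c \<alpha> F (\<lambda>x. c * q x)"
    unfolding holder_on_def
  proof (intro ballI)
    fix x y assume "x \<in> F" "y \<in> F"
    then have "\<bar>q x - q y\<bar> \<le> 1 * dist x y powr \<alpha>" using holder_q unfolding holder_on_def by blast
    then have "c * \<bar>q x - q y\<bar> \<le> c * dist x y powr \<alpha>" using c by (intro mult_left_mono) auto
    then show "\<bar>c * q x - c * q y\<bar> \<le> c * dist x y powr \<alpha>"
      using c by (simp add: abs_mult flip: right_diff_distrib)
  qed
  have "\<bar>c * q x\<bar> \<le> c * B" if "x \<in> F" for x
    using B(2)[OF that] c by (simp add: abs_mult)
  then have bdd: "bounded ((\<lambda>x. c * q x) ` F)"
    by (auto simp: bounded_iff)
  obtain L k where L: "0 < L" and k: "\<And>x y. \<bar>k x - k y\<bar> \<le> c * dist x y powr \<alpha>"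
    "\<And>x y. \<bar>k x - k y\<bar> \<le> L * dist x y" and kq: "\<And>x. x \<in> F \<Longrightarrow> \<bar>k x - c * q x\<bar> \<le> \<epsilon> / 4"
    using holder_lipschitz_approximation[OF F(1) bdd c(1) \<alpha>(1) less_imp_le[OF \<alpha>(2)] holder_cq, of "\<epsilon> / 4"] \<epsilon>
    by auto
  have "1 < (2::real) powr (1 - \<alpha>)" using \<alpha> by (intro gr_one_powr) auto
  \<comment> \<open>The three bounds serve close pairs of points, distant pairs, and the uniform distance to \<open>k\<close>.\<close>
  then obtain n where n: "max (64 * L) (max (8 * L / \<kappa>) (8 * L / \<epsilon>)) < (2 powr (1 - \<alpha>)) ^ n"
    using real_arch_pow by blast
  have pow: "(2 powr (1 - \<alpha>)) ^ n = ((2::real) ^ n) powr (1 - \<alpha>)"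
    by (simp add: powr_powr powr_power mult.commute flip: powr_realpow)
  have n1: "64 * L \<le> (2 ^ n) powr (1 - \<alpha>)" "8 * L \<le> (1 - c) * (2 ^ n) powr (1 - \<alpha>)"
    using n \<kappa> unfolding pow by (auto simp: c_def field_simps)
  have "((2::real) ^ n) powr (1 - \<alpha>) \<le> (2 ^ n) powr 1"
    using \<alpha> by (intro powr_mono) auto
  then have "8 * L / \<epsilon> \<le> 2 ^ n" using n unfolding pow by simp
  then have n2: "2 * L / 2 ^ n \<le> \<epsilon> / 4" using \<epsilon> by (simp add: field_simps)
  have plane: "\<exists>s t. x = affine_point a e f s t" if "x \<in> F" for x
    using cells[OF that, of 0] unfolding cell_def by blast
  obtain N \<delta> where \<delta>: "0 < \<delta>" and thin: "thin_levels_near F d \<eta> (terraced k a e f e' f' p n N) \<delta>"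
    using terraced_thin_levels[OF _ p(2) _ L k(2) \<eta> cells, of d F n] p d by (auto simp: p_def)
  define g where "g = restrict (terraced k a e f e' f' p n N) F"
  have "holder_on 1 \<alpha> F (terraced k a e f e' f' p n N)"
    using terraced_holder[OF \<alpha> p_def less_imp_le[OF L] k(2) c k(1) n1 plane] by blast
  then have "g \<in> mspace (holder_space \<alpha> F)"
    using F \<alpha> by (simp add: mspace_holder_space g_def holder_on_def)
  moreover have "\<bar>q x - g x\<bar> \<le> \<epsilon>" if x: "x \<in> F" for x
  proof -
    obtain s t where "x = affine_point a e f s t" using plane[OF x] by blast
    then have "\<bar>terraced k a e f e' f' p n N x - k x\<bar> \<le> 2 * L / 2 ^ n"
      using terraced_near[OF p(3,4) less_imp_le[OF L] k(2)] by blast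
    moreover have "\<bar>c * q x - q x\<bar> \<le> \<epsilon> / 4"
    proof -
      have "c * q x - q x = - (\<kappa> * q x)" by (simp add: c_def algebra_simps)
      then have "\<bar>c * q x - q x\<bar> = \<kappa> * \<bar>q x\<bar>" using \<kappa> by (simp add: abs_mult)
      also have "\<dots> \<le> \<kappa> * B" using B(2)[OF x] \<kappa> by (intro mult_left_mono) auto
      finally show ?thesis using \<kappa> by simp
    qed
    moreover have "g x = terraced k a e f e' f' p n N x" using x by (simp add: g_def)
    ultimately show ?thesis using kq[OF x] n2 \<epsilon> by linarith
  qed
  moreover have "thin_levels_near F d \<eta> g \<delta>"
    using thin thin_levels_near_cong[of F g "terraced k a e f e' f' p n N"] by (simp add: g_def)
  ultimately show ?thesis using \<delta> by blast
qed

end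

theorem theorem4p5:
  fixes a b c :: "real^2" and \<alpha> :: real
  assumes "dist a b = 1" and "dist b c = 1" and "dist a c = 1"
    and "0 < \<alpha>" and "\<alpha> < 1"
  shows "D_star \<alpha> (sierpinski (a, b, c)) \<le> ennreal (1 - 2 powr (- \<alpha>))"
proof -
  let ?F = "sierpinski (a, b, c)" and ?p = "2 powr (- \<alpha>)"
  obtain e' f' where "affine_frame (b - a) (c - a) e' f'"
    using equilateral_affine_frame[OF assms(1-3)] .
  then interpret affine_frame a "b - a" "c - a" e' f' .
  have F: "?F \<noteq> {}" "bounded ?F"
    using vertex_in_sierpinski[of a b c] bounded_sierpinski by auto
  have cells: "\<exists>w\<in>words M. x \<in> cell a (b - a) (c - a) w" if "x \<in> ?F" for M x
    using sierpinski_subset_cells[of x a "b - a" "c - a" M] that by simp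
  have "(\<lambda>x\<in>?F. 0) \<in> mspace (holder_space \<alpha> ?F)"
    using F(2) assms(4) by (simp add: mspace_holder_space holder_on_def)
  then have ne: "mspace (holder_space \<alpha> ?F) \<noteq> {}" by blast
  have p: "?p < 1" using heavy_mass_bounds(2)[OF assms(4,5) refl] .
  show ?thesis
  proof (rule ennreal_le_epsilon)
    fix \<epsilon> :: real assume \<epsilon>: "0 < \<epsilon>"
    have "D_star \<alpha> ?F \<le> ennreal (1 - ?p + \<epsilon>)"
    proof (rule D_star_le_if_thin_levels_dense[OF F(1) _ _ ne])
      show "0 \<le> 1 - ?p + \<epsilon>" using p \<epsilon> by linarith
    qed (use thin_levels_dense[OF assms(4,5) _ F cells, of "1 - ?p + \<epsilon>"] \<epsilon> in auto)
    also have "\<dots> = ennreal (1 - ?p) + ennreal \<epsilon>"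
      using p \<epsilon> by (intro ennreal_plus) auto
    finally show "D_star \<alpha> ?F \<le> ennreal (1 - ?p) + ennreal \<epsilon>" .
  qed
qed

end
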